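(* For a pair of Sevostyanov triples $(\epsilon^\pm,\mathsf n^\pm,c^\pm)$ (with $c_i^\pm\in\mathsf k^\times$) and every $\beta\in Q_+$, $$\tilde J_\beta=\sum_{0\le\gamma\le\beta}\frac1{(v^2)_{\beta-\gamma}}\,v^{(\gamma,\gamma)-2(\lambda+\rho,\gamma)}\,c^{\beta-\gamma}\,v^{\tau_\lambda(\beta-\gamma,\beta)}\cdot\tilde J_\gamma ,$$ where for $\alpha=\sum_{i=1}^nm_i\alpha_i\in Q_+$ $$(v^2)_\alpha=\prod_{i=1}^n(v_i^2;v_i^2)_{m_i},\qquad c^\alpha=\prod_{i=1}^n\bigl(-c_i^+c_i^-(v_i-v_i^{-1})^2\bigr)^{m_i},$$ $$\tau_\lambda(\alpha,\beta)=\sum_{i=1}^nm_i(\nu_i^--\nu_i^+,\lambda-\beta)+\sum_{j\prec_+i}m_im_j(\nu_i^--\nu_i^+,\alpha_j)+\sum_{i=1}^n\frac{m_i(m_i-1)}2(\nu_i^--\nu_i^+,\alpha_i).$$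
   Context: **Lie data.** $\mathfrak g$ is a complex semisimple Lie algebra of rank $n$ with simple roots $\alpha_i$, fundamental weights $\omega_i$, weight lattice $P$, root lattice $Q$, $Q_+=\bigoplus\mathbb Z_{\ge0}\alpha_i$, positive roots $\Delta_+$, $\rho=\sum\omega_i$; $\beta\ge\gamma$ means $\beta-\gamma\in Q_+$. The invariant form is normalized so that $\mathsf d_i=(\alpha_i,\alpha_i)/2$ equals $1$ for short roots; $a_{ij}=2(\alpha_i,\alpha_j)/(\alpha_i,\alpha_i)$, $b_{ij}=(\alpha_i,\alpha_j)$, $v_i=v^{\mathsf d_i}$. Fix $N\in\mathbb Z_{>0}$ with $(P,P)\subset\frac1N\mathbb Z$. **Quantum group.** $U_v(\mathfrak g)$ is the $\mathbb C(v^{1/N})$-algebra generated by $E_i,F_i,K_\mu$ ($\mu\in P$) with $K_\mu K_{\mu'}=K_{\mu+\mu'}$, $K_0=1$, $K_\mu E_iK_\mu^{-1}=v^{(\mu,\alpha_i)}E_i$, $K_\mu F_iK_\mu^{-1}=v^{-(\mu,\alpha_i)}F_i$, $[E_i,F_j]=\delta_{ij}\frac{K_{\alpha_i}-K_{\alpha_i}^{-1}}{v_i-v_i^{-1}}$ and the $v$-Serre relations; $L_i=K_{\omega_i}$. $U_{v^{-1}}(\mathfrak g)$ is the analogous algebra with $v$ replaced by $v^{-1}$, with generators $\bar E_i,\bar F_i,\bar K_\mu$, $\bar L_i=\bar K_{\omega_i}$. **Sevostyanov triples.** A triple $(\epsilon,\mathsf n,c)$: $\epsilon$ is the matrix of an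 orientation of the simple graph underlying the Dynkin diagram ($\epsilon_{ij}=1$ if $i\to j$, $-1$ if $i\leftarrow j$, $0$ if $i=j$ or $a_{ij}=0$); $\mathsf n$ is an integer $n\times n$ matrix with $\mathsf d_j\mathsf n_{ij}-\mathsf d_i\mathsf n_{ji}=\epsilon_{ij}b_{ij}$; $c=(c_i)$ are nonzero scalars (here in $\mathsf k^\times$, see below). Put $\nu_i^\pm=\sum_k\mathsf n^\pm_{ik}\omega_k\in P$. **Verma modules.** $\mathsf k=\mathbb C(v^{1/N},u_1,\dots,u_n)$ with $u_i$ indeterminates. $\lambda$ is a formal symbol with $v^{(\lambda,\sum m_i\omega_i)}:=\prod u_i^{m_i}$ for $m_i\in\mathbb Z$. $\mathcal V$ is the universal Verma $U_v(\mathfrak g)$-module over $\mathsf k$ generated by $\mathbf 1$ with $E_i\mathbf 1=0$, $L_i\mathbf 1=u_i\mathbf 1$; $\mathcal V=\bigoplus_{\beta\in Q_+}\mathcal V_\beta$ with $K_\mu=v^{(\mu,\lambda-\beta)}$ on $\mathcal V_\beta$. $\bar{\mathcal V}$ is the universal Verma $U_{v^{-1}}(\mathfrak g)$-module generated by $\bar{\mathbf 1}$ with $\bar E_i\bar{\mathbf 1}=0$, $\bar L_i\bar{\mathbf 1}=u_i^{-1}\bar{\mathbf 1}$, graded similarly with $\bar K_\mu=v^{-(\mu,\lambda-\beta)}$ on $\bar{\mathcal V}_\beta$. There is a unique nondegenerate $\mathsf k$-bilinear pairing $(\cdot,\cdot):\mathcal V\times\bar{\mathcal V}\to\mathsf k$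 with $(\mathbf 1,\bar{\mathbf 1})=1$ and $(xw,w')=(w,\sigma(x)w')$, where $\sigma:U_v(\mathfrak g)\to U_{v^{-1}}(\mathfrak g)$ is the algebra anti-isomorphism $E_i\mapsto\bar F_i$, $F_i\mapsto\bar E_i$, $L_i\mapsto\bar L_i^{-1}$. **Whittaker vectors.** $\theta=\sum_{\beta}\theta_\beta\in\prod_\beta\mathcal V_\beta$ and $\bar\theta=\sum_\beta\bar\theta_\beta\in\prod_\beta\bar{\mathcal V}_\beta$ are uniquely determined by $\theta_0=\mathbf 1$, $E_iK_{\nu_i^+}(\theta)=c_i^+\theta$ and $\bar\theta_0=\bar{\mathbf 1}$, $\bar E_i\bar K_{\nu_i^-}(\bar\theta)=c_i^-\bar\theta$ for all $i$. Put $\tilde J_\beta=v^{-(\beta,\beta)/2+(\lambda,\beta)}(\theta_\beta,\bar\theta_\beta)$. **Other notation.** $(t;t)_r=\prod_{k=1}^r(1-t^k)$, $(t;t)_0=1$. An ordering $\prec$ of $\Delta_+$ is convex if $\gamma=\alpha+\beta$ (all in $\Delta_+$) implies $\alpha\prec\gamma\prec\beta$ or $\beta\prec\gamma\prec\alpha$. $\prec_+$ is a convex ordering chosen so that $\epsilon^+_{ij}=-1\Rightarrow\alpha_i\prec_+\alpha_j$; $j\prec_+i$ means $\alpha_j\prec_+\alpha_i$. *)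

theory Defs
  imports
    "HOL-Analysis.Analysis"
    "HOL-Library.Poly_Mapping"
    "HOL-Library.Option_ord"
    "HOL-Computational_Algebra.Fraction_Field"
begin

text \<open>
  A complex semisimple Lie algebra enters through its (reduced, crystallographic) root system
  \<open>\<Delta>\<close> in a Euclidean space, together with simple roots \<open>\<alpha>\<close> indexed by a finite linearly ordered
  type \<open>'i\<close> (the labels \<open>1, \<dots>, n\<close>).  The inner product is the invariant form.
\<close>

definition root_system :: "'e::euclidean_space set \<Rightarrow> bool" where
  "root_system \<Delta> \<longleftrightarrow>
     finite \<Delta> \<and> 0 \<notin> \<Delta> \<and> span \<Delta> = UNIV \<and>
     (\<forall>x\<in>\<Delta>. \<forall>y\<in>\<Delta>. y - (2 * (x \<bullet> y) / (x \<bullet> x)) *\<^sub>R x \<in> \<Delta>) \<and>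
     (\<forall>x\<in>\<Delta>. \<forall>y\<in>\<Delta>. 2 * (x \<bullet> y) / (x \<bullet> x) \<in> \<int>) \<and>
     (\<forall>x\<in>\<Delta>. \<forall>t. t *\<^sub>R x \<in> \<Delta> \<longrightarrow> t = 1 \<or> t = -1)"

text \<open>
  \<open>Q\<^sub>+\<close> is represented by its coordinates \<open>m :: 'i \<Rightarrow> nat\<close> with respect to the simple roots, and
  \<open>P\<close> by coordinates \<open>\<mu> :: 'i \<Rightarrow> int\<close> with respect to the fundamental weights.  The pointwise
  order on \<open>'i \<Rightarrow> nat\<close> is then the order \<open>\<beta> \<ge> \<gamma> \<longleftrightarrow> \<beta> - \<gamma> \<in> Q\<^sub>+\<close>.
\<close>

definition qvec :: "('i::finite \<Rightarrow> 'e::euclidean_space) \<Rightarrow> ('i \<Rightarrow> nat) \<Rightarrow> 'e" where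
  "qvec \<alpha> m = (\<Sum>i\<in>UNIV. real (m i) *\<^sub>R \<alpha> i)"

definition simple_roots :: "'e::euclidean_space set \<Rightarrow> ('i::finite \<Rightarrow> 'e) \<Rightarrow> bool" where
  "simple_roots \<Delta> \<alpha> \<longleftrightarrow>
     inj \<alpha> \<and> range \<alpha> \<subseteq> \<Delta> \<and> independent (range \<alpha>) \<and>
     (\<forall>x\<in>\<Delta>. \<exists>m. x = qvec \<alpha> m \<or> x = - qvec \<alpha> m)"

definition positive_roots :: "'e::euclidean_space set \<Rightarrow> ('i::finite \<Rightarrow> 'e) \<Rightarrow> 'e set" where
  "positive_roots \<Delta> \<alpha> = {x \<in> \<Delta>. \<exists>m. x = qvec \<alpha> m}"

text \<open>
  A root is short if it has minimal length within its irreducible component; the components are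
  the classes of the equivalence relation generated by non-orthogonality.
\<close>

definition short_root :: "'e::euclidean_space set \<Rightarrow> 'e \<Rightarrow> bool" where
  "short_root \<Delta> x \<longleftrightarrow> x \<in> \<Delta> \<and>
     (\<forall>y. (x, y) \<in> {(a, b). a \<in> \<Delta> \<and> b \<in> \<Delta> \<and> a \<bullet> b \<noteq> 0}\<^sup>* \<longrightarrow> x \<bullet> x \<le> y \<bullet> y)"

definition normalized_form :: "'e::euclidean_space set \<Rightarrow> bool" where
  "normalized_form \<Delta> \<longleftrightarrow> (\<forall>x. short_root \<Delta> x \<longrightarrow> x \<bullet> x / 2 = 1)"

definition dd :: "('i \<Rightarrow> 'e::euclidean_space) \<Rightarrow> 'i \<Rightarrow> real" where
  "dd \<alpha> i = \<alpha> i \<bullet> \<alpha> i / 2"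

text \<open>The floor only changes the type: Cartan integers are integers.\<close>

definition cartan :: "('i \<Rightarrow> 'e::euclidean_space) \<Rightarrow> 'i \<Rightarrow> 'i \<Rightarrow> int" where
  "cartan \<alpha> i j = \<lfloor>2 * (\<alpha> i \<bullet> \<alpha> j) / (\<alpha> i \<bullet> \<alpha> i)\<rfloor>"

definition fund_weight :: "('i::finite \<Rightarrow> 'e::euclidean_space) \<Rightarrow> 'i \<Rightarrow> 'e" where
  "fund_weight \<alpha> i =
     (THE x. \<forall>j. 2 * (x \<bullet> \<alpha> j) / (\<alpha> j \<bullet> \<alpha> j) = (if j = i then 1 else 0))"

definition pvec :: "('i::finite \<Rightarrow> 'e::euclidean_space) \<Rightarrow> ('i \<Rightarrow> int) \<Rightarrow> 'e" where
  "pvec \<alpha> \<mu> = (\<Sum>i\<in>UNIV. of_int (\<mu> i) *\<^sub>R fund_weight \<alpha> i)"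

definition weyl_vector :: "('i::finite \<Rightarrow> 'e::euclidean_space) \<Rightarrow> 'e" where
  "weyl_vector \<alpha> = (\<Sum>i\<in>UNIV. fund_weight \<alpha> i)"

definition convex_ordering ::
  "'e::euclidean_space set \<Rightarrow> ('i::finite \<Rightarrow> 'e) \<Rightarrow> ('e \<Rightarrow> 'e \<Rightarrow> bool) \<Rightarrow> bool" where
  "convex_ordering \<Delta> \<alpha> prec \<longleftrightarrow>
     (\<forall>x\<in>positive_roots \<Delta> \<alpha>. \<not> prec x x) \<and>
     (\<forall>x\<in>positive_roots \<Delta> \<alpha>. \<forall>y\<in>positive_roots \<Delta> \<alpha>. x \<noteq> y \<longrightarrow> prec x y \<or> prec y x) \<and>
     (\<forall>x\<in>positive_roots \<Delta> \<alpha>. \<forall>y\<in>positive_roots \<Delta> \<alpha>. \<forall>z\<in>positive_roots \<Delta> \<alpha>.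
        prec x y \<and> prec y z \<longrightarrow> prec x z) \<and>
     (\<forall>x\<in>positive_roots \<Delta> \<alpha>. \<forall>y\<in>positive_roots \<Delta> \<alpha>. \<forall>z\<in>positive_roots \<Delta> \<alpha>.
        z = x + y \<longrightarrow> (prec x z \<and> prec z y) \<or> (prec y z \<and> prec z x))"

definition orientation_matrix ::
  "('i \<Rightarrow> 'e::euclidean_space) \<Rightarrow> ('i \<Rightarrow> 'i \<Rightarrow> int) \<Rightarrow> bool" where
  "orientation_matrix \<alpha> \<epsilon> \<longleftrightarrow>
     (\<forall>i j. if i = j \<or> cartan \<alpha> i j = 0 then \<epsilon> i j = 0
            else \<epsilon> i j \<in> {1, -1} \<and> \<epsilon> j i = - \<epsilon> i j)"

definition sevostyanov_triple ::
  "('i \<Rightarrow> 'e::euclidean_space) \<Rightarrow> ('i \<Rightarrow> 'i \<Rightarrow> int) \<Rightarrow> ('i \<Rightarrow> 'i \<Rightarrow> int) \<Rightarrow> ('i \<Rightarrow> 'k::field) \<Rightarrow> bool"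
  where
  "sevostyanov_triple \<alpha> \<epsilon> n c \<longleftrightarrow>
     orientation_matrix \<alpha> \<epsilon> \<and>
     (\<forall>i j. dd \<alpha> j * of_int (n i j) - dd \<alpha> i * of_int (n j i) = of_int (\<epsilon> i j) * (\<alpha> i \<bullet> \<alpha> j)) \<and>
     (\<forall>i. c i \<noteq> 0)"

text \<open>
  The field \<open>\<complex>(v\<^bsup>1/N\<^esup>, u\<^sub>1, \<dots>, u\<^sub>n)\<close>: the variable \<open>None\<close> is \<open>v\<^bsup>1/N\<^esup>\<close>, the variable
  \<open>Some i\<close> is \<open>u\<^sub>i\<close>.
\<close>

type_synonym 'i kfield = "(('i option \<Rightarrow>\<^sub>0 nat) \<Rightarrow>\<^sub>0 complex) fract"

definition kvar :: "'i::linorder option \<Rightarrow> 'i kfield" where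
  "kvar x = Fract (Poly_Mapping.single (Poly_Mapping.single x 1) 1) 1"

definition vroot :: "'i::linorder kfield" where
  "vroot = kvar None"

definition uvar :: "'i::linorder \<Rightarrow> 'i kfield" where
  "uvar i = kvar (Some i)"

text \<open>
  A pair \<open>(\<mu>, r)\<close> with \<open>\<mu> \<in> P\<close> and \<open>r \<in> (1/N) \<int>\<close> stands for the exponent \<open>(\<lambda>, \<mu>) + r\<close>.
  With \<open>w\<close> in the role of \<open>v\<^bsup>1/N\<^esup>\<close>, \<open>vexp \<alpha> N w u\<close> maps it to
  \<open>v\<^bsup>(\<lambda>,\<mu>) + r\<^esup> = v\<^sup>r \<Prod> u\<^sub>i\<^bsup>m\<^sub>i\<^esup>\<close> where \<open>\<mu> = \<Sum> m\<^sub>i \<omega>\<^sub>i\<close>, that is,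
  \<open>m\<^sub>i = 2 (\<mu>, \<alpha>\<^sub>i) / (\<alpha>\<^sub>i, \<alpha>\<^sub>i)\<close>.  Both floors are taken of integers for such a pair.
  Replacing \<open>(w, u)\<close> by inverses turns \<open>v\<^sup>x\<close> into \<open>v\<^bsup>-x\<^esup>\<close>.
\<close>

definition lam_pair :: "'e::euclidean_space \<Rightarrow> 'e \<Rightarrow> 'e \<times> real" where
  "lam_pair \<xi> \<mu> = (\<mu>, \<xi> \<bullet> \<mu>)"  \<comment> \<open>the exponent \<open>(\<lambda> + \<xi>, \<mu>)\<close>\<close>

definition num :: "real \<Rightarrow> 'e::euclidean_space \<times> real" where
  "num r = (0, r)"

definition vpow :: "nat \<Rightarrow> 'k::field \<Rightarrow> real \<Rightarrow> 'k" where
  "vpow N w r = w powi \<lfloor>real N * r\<rfloor>"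

definition vexp ::
  "('i::finite \<Rightarrow> 'e::euclidean_space) \<Rightarrow> nat \<Rightarrow> 'k::field \<Rightarrow> ('i \<Rightarrow> 'k) \<Rightarrow> 'e \<times> real \<Rightarrow> 'k" where
  "vexp \<alpha> N w u x =
     vpow N w (snd x) * (\<Prod>i\<in>UNIV. u i powi \<lfloor>2 * (fst x \<bullet> \<alpha> i) / (\<alpha> i \<bullet> \<alpha> i)\<rfloor>)"

definition vi :: "('i \<Rightarrow> 'e::euclidean_space) \<Rightarrow> nat \<Rightarrow> 'k::field \<Rightarrow> 'i \<Rightarrow> 'k" where
  "vi \<alpha> N w i = vpow N w (dd \<alpha> i)"

datatype 'i qgen = GE 'i | GF 'i | GK "'i \<Rightarrow> int"

text \<open>Words under concatenation; finitely supported functions on them form the free algebra.\<close>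

datatype 'g word = Word "'g list"

instantiation word :: (type) monoid_add
begin

definition zero_word :: "'a word" where
  "zero_word = Word []"

fun plus_word :: "'a word \<Rightarrow> 'a word \<Rightarrow> 'a word" where
  "plus_word (Word a) (Word b) = Word (a @ b)"

instance
proof
  fix a b c :: "'a word"
  show "a + b + c = a + (b + c)" by (cases a; cases b; cases c) simp
  show "0 + a = a" "a + 0 = a" by (cases a; simp add: zero_word_def)+
qed

end

type_synonym ('i, 'k) qfree = "'i qgen word \<Rightarrow>\<^sub>0 'k"

definition gen :: "'i qgen \<Rightarrow> ('i, 'k::field) qfree" where
  "gen g = Poly_Mapping.single (Word [g]) 1"

abbreviation "qE i \<equiv> gen (GE i)"
abbreviation "qF i \<equiv> gen (GF i)"
abbreviation "qK \<mu> \<equiv> gen (GK \<mu>)"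

definition const :: "'k::field \<Rightarrow> ('i, 'k) qfree" where
  "const c = Poly_Mapping.single 0 c"

definition qL :: "'i \<Rightarrow> ('i, 'k::field) qfree" where
  "qL i = qK (\<lambda>j. if j = i then 1 else 0)"

text \<open>\<open>K\<close> and its inverse at \<open>\<alpha>\<^sub>i = \<Sum>\<^sub>j a\<^sub>j\<^sub>i \<omega>\<^sub>j\<close>.\<close>

definition qKalpha :: "('i \<Rightarrow> 'e::euclidean_space) \<Rightarrow> 'i \<Rightarrow> ('i, 'k::field) qfree" where
  "qKalpha \<alpha> i = qK (\<lambda>j. cartan \<alpha> j i)"

definition qKalpha_inv :: "('i \<Rightarrow> 'e::euclidean_space) \<Rightarrow> 'i \<Rightarrow> ('i, 'k::field) qfree" where
  "qKalpha_inv \<alpha> i = qK (\<lambda>j. - cartan \<alpha> j i)"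

definition qint :: "'k::field \<Rightarrow> nat \<Rightarrow> 'k" where
  "qint q m = (q ^ m - inverse q ^ m) / (q - inverse q)"

definition qfact :: "'k::field \<Rightarrow> nat \<Rightarrow> 'k" where
  "qfact q m = (\<Prod>k=1..m. qint q k)"

definition qbinom :: "'k::field \<Rightarrow> nat \<Rightarrow> nat \<Rightarrow> 'k" where
  "qbinom q m r = qfact q m / (qfact q r * qfact q (m - r))"

definition serre_element ::
  "'k::field \<Rightarrow> nat \<Rightarrow> ('i, 'k) qfree \<Rightarrow> ('i, 'k) qfree \<Rightarrow> ('i, 'k) qfree" where
  "serre_element q m x y =
     (\<Sum>r\<le>m. const ((-1) ^ r * qbinom q m r) * x ^ (m - r) * y * x ^ r)"

text \<open>
  The elements of the free algebra that vanish in the quantum group \<open>U\<^sub>v\<close>.  The relations make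
  sense over any field with a distinguished element \<open>w\<close> playing the role of \<open>v\<^bsup>1/N\<^esup>\<close>;
  the algebra \<open>U\<^bsub>v\<^sup>-\<^sup>1\<^esub>\<close> is obtained from \<open>inverse w\<close>.
\<close>

definition qrelations ::
  "('i::finite \<Rightarrow> 'e::euclidean_space) \<Rightarrow> nat \<Rightarrow> 'k::field \<Rightarrow> ('i, 'k) qfree set" where
  "qrelations \<alpha> N w =
     {qK \<mu> * qK \<mu>' - qK (\<lambda>i. \<mu> i + \<mu>' i) | \<mu> \<mu>'. True} \<union>
     {qK (\<lambda>i. 0) - 1} \<union>
     {qK \<mu> * qE i * qK (\<lambda>j. - \<mu> j) - const (vpow N w (pvec \<alpha> \<mu> \<bullet> \<alpha> i)) * qE i | \<mu> i. True} \<union>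
     {qK \<mu> * qF i * qK (\<lambda>j. - \<mu> j) - const (vpow N w (- (pvec \<alpha> \<mu> \<bullet> \<alpha> i))) * qF i | \<mu> i. True} \<union>
     {qE i * qF j - qF j * qE i
        - (if i = j
           then const (inverse (vi \<alpha> N w i - inverse (vi \<alpha> N w i))) * (qKalpha \<alpha> i - qKalpha_inv \<alpha> i)
           else 0) | i j. True} \<union>
     {serre_element (vi \<alpha> N w i) (nat (1 - cartan \<alpha> i j)) (qE i) (qE j) | i j. i \<noteq> j} \<union>
     {serre_element (vi \<alpha> N w i) (nat (1 - cartan \<alpha> i j)) (qF i) (qF j) | i j. i \<noteq> j}"

definition left_ideal :: "'r::ring_1 set \<Rightarrow> bool" where
  "left_ideal I \<longleftrightarrow> 0 \<in> I \<and> (\<forall>x\<in>I. \<forall>y\<in>I. x + y \<in> I) \<and> (\<forall>a. \<forall>x\<in>I. a * x \<in> I)"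

definition twosided_ideal :: "'r::ring_1 set \<Rightarrow> bool" where
  "twosided_ideal I \<longleftrightarrow> left_ideal I \<and> (\<forall>a. \<forall>x\<in>I. x * a \<in> I)"

text \<open>The quantum group is the free algebra modulo the following ideal.\<close>

definition uq_ideal ::
  "('i::finite \<Rightarrow> 'e::euclidean_space) \<Rightarrow> nat \<Rightarrow> 'k::field \<Rightarrow> ('i, 'k) qfree set" where
  "uq_ideal \<alpha> N w = twosided_ideal hull (qrelations \<alpha> N w)"

text \<open>
  The anti-homomorphism of free algebras that induces the anti-isomorphism \<open>\<sigma>\<close> from \<open>U\<^sub>v\<close> to
  \<open>U\<^bsub>v\<^sup>-\<^sup>1\<^esub>\<close>; the generators of the target carry the same names as those of the source.
\<close>

fun sigma_gen :: "'i qgen \<Rightarrow> 'i qgen" where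
  "sigma_gen (GE i) = GF i"
| "sigma_gen (GF i) = GE i"
| "sigma_gen (GK \<mu>) = GK (\<lambda>j. - \<mu> j)"

fun sigma_word :: "'i qgen word \<Rightarrow> 'i qgen word" where
  "sigma_word (Word gs) = Word (rev (map sigma_gen gs))"

definition sigma :: "('i, 'k::field) qfree \<Rightarrow> ('i, 'k) qfree" where
  "sigma x = (\<Sum>m\<in>Poly_Mapping.keys x.
                Poly_Mapping.single (sigma_word m) (Poly_Mapping.lookup x m))"

text \<open>
  A module over the quantum group is a module over the free algebra on which the defining ideal
  acts by zero.
\<close>

definition uq_module ::
  "('i::finite \<Rightarrow> 'e::euclidean_space) \<Rightarrow> nat \<Rightarrow> 'k::field \<Rightarrow>
   ('k \<Rightarrow> 'v \<Rightarrow> 'v) \<Rightarrow> (('i, 'k) qfree \<Rightarrow> 'v \<Rightarrow> 'v::ab_group_add) \<Rightarrow> bool" where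
  "uq_module \<alpha> N w scl act \<longleftrightarrow>
     vector_space scl \<and>
     (\<forall>x. Vector_Spaces.linear scl scl (act x)) \<and>
     (\<forall>x y m. act (x + y) m = act x m + act y m) \<and>
     (\<forall>x y m. act (x * y) m = act x (act y m)) \<and>
     (\<forall>c m. act (const c) m = scl c m) \<and>
     (\<forall>x\<in>uq_ideal \<alpha> N w. \<forall>m. act x m = 0)"

text \<open>
  The universal Verma module is presented by one generator \<open>one\<close> and the relations
  \<open>E\<^sub>i one = 0\<close>, \<open>L\<^sub>i one = u\<^sub>i one\<close>, so the annihilator of \<open>one\<close> in the free algebra is exactly
  the left ideal below.
\<close>

definition verma_ideal ::
  "('i::finite \<Rightarrow> 'e::euclidean_space) \<Rightarrow> nat \<Rightarrow> 'k::field \<Rightarrow> ('i \<Rightarrow> 'k) \<Rightarrow> ('i, 'k) qfree set" where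
  "verma_ideal \<alpha> N w u =
     left_ideal hull (uq_ideal \<alpha> N w \<union> range qE \<union> range (\<lambda>i. qL i - const (u i)))"

definition verma_module ::
  "('i::finite \<Rightarrow> 'e::euclidean_space) \<Rightarrow> nat \<Rightarrow> 'k::field \<Rightarrow> ('i \<Rightarrow> 'k) \<Rightarrow>
   ('k \<Rightarrow> 'v \<Rightarrow> 'v) \<Rightarrow> (('i, 'k) qfree \<Rightarrow> 'v \<Rightarrow> 'v::ab_group_add) \<Rightarrow> 'v \<Rightarrow> bool" where
  "verma_module \<alpha> N w u scl act one \<longleftrightarrow>
     uq_module \<alpha> N w scl act \<and>
     (\<forall>m. \<exists>x. m = act x one) \<and>
     (\<forall>x. act x one = 0 \<longleftrightarrow> x \<in> verma_ideal \<alpha> N w u)"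

text \<open>The component of degree \<open>\<beta>\<close>, where \<open>K\<^sub>\<mu>\<close> acts by \<open>v\<^bsup>(\<mu>, \<lambda> - \<beta>)\<^esup>\<close>.\<close>

definition weight_space ::
  "('i::finite \<Rightarrow> 'e::euclidean_space) \<Rightarrow> nat \<Rightarrow> 'k::field \<Rightarrow> ('i \<Rightarrow> 'k) \<Rightarrow>
   ('k \<Rightarrow> 'v \<Rightarrow> 'v) \<Rightarrow> (('i, 'k) qfree \<Rightarrow> 'v \<Rightarrow> 'v) \<Rightarrow> ('i \<Rightarrow> nat) \<Rightarrow> 'v set" where
  "weight_space \<alpha> N w u scl act \<beta> =
     {m. \<forall>\<mu>. act (qK \<mu>) m = scl (vexp \<alpha> N w u (lam_pair (- qvec \<alpha> \<beta>) (pvec \<alpha> \<mu>))) m}"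

definition shapovalov_pairing ::
  "('k::field \<Rightarrow> 'v \<Rightarrow> 'v) \<Rightarrow> (('i, 'k) qfree \<Rightarrow> 'v \<Rightarrow> 'v::ab_group_add) \<Rightarrow> 'v \<Rightarrow>
   ('k \<Rightarrow> 'w \<Rightarrow> 'w) \<Rightarrow> (('i, 'k) qfree \<Rightarrow> 'w \<Rightarrow> 'w::ab_group_add) \<Rightarrow> 'w \<Rightarrow>
   ('v \<Rightarrow> 'w \<Rightarrow> 'k) \<Rightarrow> bool" where
  "shapovalov_pairing scl act one scl' act' one' pr \<longleftrightarrow>
     (\<forall>y. Vector_Spaces.linear scl (*) (\<lambda>x. pr x y)) \<and>
     (\<forall>x. Vector_Spaces.linear scl' (*) (\<lambda>y. pr x y)) \<and>
     (\<forall>x. (\<forall>y. pr x y = 0) \<longrightarrow> x = 0) \<and>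
     (\<forall>y. (\<forall>x. pr x y = 0) \<longrightarrow> y = 0) \<and>
     pr one one' = 1 \<and>
     (\<forall>a x y. pr (act a x) y = pr x (act' (sigma a) y))"

text \<open>
  An element of \<open>\<Prod>\<^sub>\<beta> V\<^sub>\<beta>\<close> is a family \<open>\<theta>\<close>.  Since \<open>E\<^sub>i\<close> maps the component of degree
  \<open>\<beta> + \<alpha>\<^sub>i\<close> to that of degree \<open>\<beta>\<close>, the equation \<open>E\<^sub>i K\<^bsub>\<nu>\<^sub>i\<^esub> (\<theta>) = c\<^sub>i \<theta>\<close> with
  \<open>\<nu>\<^sub>i = \<Sum>\<^sub>k n\<^sub>i\<^sub>k \<omega>\<^sub>k\<close> reads componentwise as follows.
\<close>

definition whittaker_vector ::
  "('i::finite \<Rightarrow> 'e::euclidean_space) \<Rightarrow> nat \<Rightarrow> 'k::field \<Rightarrow> ('i \<Rightarrow> 'k) \<Rightarrow>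
   ('k \<Rightarrow> 'v \<Rightarrow> 'v) \<Rightarrow> (('i, 'k) qfree \<Rightarrow> 'v \<Rightarrow> 'v) \<Rightarrow> 'v \<Rightarrow>
   ('i \<Rightarrow> 'i \<Rightarrow> int) \<Rightarrow> ('i \<Rightarrow> 'k) \<Rightarrow> (('i \<Rightarrow> nat) \<Rightarrow> 'v) \<Rightarrow> bool" where
  "whittaker_vector \<alpha> N w u scl act one n c \<theta> \<longleftrightarrow>
     (\<forall>\<beta>. \<theta> \<beta> \<in> weight_space \<alpha> N w u scl act \<beta>) \<and>
     \<theta> (\<lambda>i. 0) = one \<and>
     (\<forall>i \<beta>. act (qE i * qK (n i)) (\<theta> (\<beta>(i := Suc (\<beta> i)))) = scl (c i) (\<theta> \<beta>))"

definition Jtilde ::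
  "('i::{finite,linorder} \<Rightarrow> 'e::euclidean_space) \<Rightarrow> nat \<Rightarrow> ('v \<Rightarrow> 'w \<Rightarrow> 'i kfield) \<Rightarrow>
   (('i \<Rightarrow> nat) \<Rightarrow> 'v) \<Rightarrow> (('i \<Rightarrow> nat) \<Rightarrow> 'w) \<Rightarrow> ('i \<Rightarrow> nat) \<Rightarrow> 'i kfield" where
  "Jtilde \<alpha> N pr \<theta> \<theta>' \<beta> =
     vexp \<alpha> N vroot uvar (num (- (qvec \<alpha> \<beta> \<bullet> qvec \<alpha> \<beta>) / 2) + lam_pair 0 (qvec \<alpha> \<beta>))
     * pr (\<theta> \<beta>) (\<theta>' \<beta>)"

definition qpoch :: "'k::field \<Rightarrow> nat \<Rightarrow> 'k" where
  "qpoch t r = (\<Prod>k=1..r. 1 - t ^ k)"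

definition v2_poch ::
  "('i::{finite,linorder} \<Rightarrow> 'e::euclidean_space) \<Rightarrow> nat \<Rightarrow> ('i \<Rightarrow> nat) \<Rightarrow> 'i kfield" where
  "v2_poch \<alpha> N m = (\<Prod>i\<in>UNIV. qpoch ((vi \<alpha> N vroot i)\<^sup>2) (m i))"

definition c_power ::
  "('i::{finite,linorder} \<Rightarrow> 'e::euclidean_space) \<Rightarrow> nat \<Rightarrow> ('i \<Rightarrow> 'i kfield) \<Rightarrow>
   ('i \<Rightarrow> 'i kfield) \<Rightarrow> ('i \<Rightarrow> nat) \<Rightarrow> 'i kfield" where
  "c_power \<alpha> N cp cm m =
     (\<Prod>i\<in>UNIV. (- cp i * cm i * (vi \<alpha> N vroot i - inverse (vi \<alpha> N vroot i))\<^sup>2) ^ m i)"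

text \<open>\<open>\<tau>\<^sub>\<lambda>\<close> as a formal exponent; \<open>np\<close>, \<open>nm\<close> are the matrices \<open>n\<^sup>+\<close>, \<open>n\<^sup>-\<close>.\<close>

definition tau ::
  "('i::finite \<Rightarrow> 'e::euclidean_space) \<Rightarrow> ('e \<Rightarrow> 'e \<Rightarrow> bool) \<Rightarrow>
   ('i \<Rightarrow> 'i \<Rightarrow> int) \<Rightarrow> ('i \<Rightarrow> 'i \<Rightarrow> int) \<Rightarrow> ('i \<Rightarrow> nat) \<Rightarrow> ('i \<Rightarrow> nat) \<Rightarrow> 'e \<times> real" where
  "tau \<alpha> prec np nm m \<beta> =
     (\<Sum>i\<in>UNIV. real (m i) *\<^sub>R lam_pair (- qvec \<alpha> \<beta>) (pvec \<alpha> (nm i) - pvec \<alpha> (np i)))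
     + num (\<Sum>(i, j) | prec (\<alpha> j) (\<alpha> i).
              real (m i) * real (m j) * ((pvec \<alpha> (nm i) - pvec \<alpha> (np i)) \<bullet> \<alpha> j))
     + num (\<Sum>i\<in>UNIV. real (m i) * (real (m i) - 1) / 2 *
              ((pvec \<alpha> (nm i) - pvec \<alpha> (np i)) \<bullet> \<alpha> i))"

end

theory Submission
  imports Defs
begin

text \<open>
  The vectors \<open>\<theta>\<^sub>\<beta>\<close> define functionals \<open>\<psi>\<^sub>\<beta> y = (\<theta>\<^sub>\<beta>, y)\<close> on the Verma module of \<open>U\<close> at \<open>q = v\<^sup>-\<^sup>1\<close>,
  and \<open>\<psi>\<close> sends \<open>F\<^sub>i y\<close> to a multiple of \<open>\<psi> y\<close>.  The quantum Casimir element \<open>\<Sum> b\<^sup>- K b\<^sup>+\<close> (sum over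
  dual bases) acts on weight vectors by explicit powers of \<open>v\<close>.  Evaluating its left factors on \<open>\<psi>\<close>
  collapses the dual bases in degree \<open>m\<close> to a single ordered product \<open>E\<^sup>m\<close> of divided powers of the \<open>E\<^sub>i\<close>:
  Sevostyanov's condition says precisely that the character of \<open>\<theta>\<close> is represented by such a product.
  The resulting identity \<open>\<Sum>\<^sub>m C\<^sub>\<beta>(m) \<psi>\<^bsub>\<beta>-m\<^esub> (E\<^sup>m y) = q\<^bsup>(\<beta>,\<beta>) - 2(\<lambda>+\<rho>,\<beta>)\<^esup> \<psi>\<^sub>\<beta> y\<close> can be verified without
  any R-matrix: it holds for the generator, and the formula for \<open>[E\<^sub>i\<^sup>k, F\<^sub>i]\<close> shows that it passes
  from \<open>y\<close> to \<open>F\<^sub>i y\<close>.  For \<open>y = \<theta>'\<^sub>\<beta>\<close>, an eigenvector of the raising operators, it becomes the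
  recursion.
\<close>

section \<open>Whittaker functionals\<close>

text \<open>The coefficients C are obtained by solving for them. Commuting \<open>F i\<close>
  through E^m makes each \<psi>(E^m y) receive three contributions: one with \<open>F i\<close>
  moved to the left, and a K-part and a K^-1-part, both coming from the index m + \<alpha>_i.
  Requiring the first to cancel the K-part prescribes the ratio C(m + \<alpha>_i) / C(m) for every i
  at once. Such increments come from a single function of m only if the mixed second differences are
  symmetric in i and j. Comparing exponents, this symmetry reads (\<nu>_i, \<alpha>_j) - (\<nu>_j,
  \<alpha>_i) = (\<alpha>_i, \<alpha>_j) whenever E_i stands to the left of E_j, which is
  Sevostyanov's condition for an ordering adapted to the orientation. The same relation then makes
  the K^-1-part fit the Casimir eigenvalue. All scalars involved, apart from the constants c and the
  q-factorials, are monomials in v^(1/N) and the u_i. Their exponents are treated as elements of a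
  real vector space, so every identity between them is linear algebra; integrality is checked
  separately and only serves to make exponentiation multiplicative.\<close>

inductive_set F_span :: "('k \<Rightarrow> 'w \<Rightarrow> 'w) \<Rightarrow> ('i \<Rightarrow> 'w \<Rightarrow> 'w) \<Rightarrow> 'w \<Rightarrow> 'w::ab_group_add set"
  for scl F one where
  one: "one \<in> F_span scl F one"
| add: "x \<in> F_span scl F one \<Longrightarrow> y \<in> F_span scl F one \<Longrightarrow> x + y \<in> F_span scl F one"
| scale: "x \<in> F_span scl F one \<Longrightarrow> scl c x \<in> F_span scl F one"
| F: "x \<in> F_span scl F one \<Longrightarrow> F i x \<in> F_span scl F one"

text \<open>Only scalars survive in this abstraction: \<open>K i\<close> and \<open>K' i\<close> are
  K at plus and minus \<alpha>_i, \<open>b i j\<close> is q to the power (\<alpha>_i, \<alpha>_j),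
  \<open>\<kappa> i \<beta>\<close> is the weight of \<open>K i\<close> under
  \<open>\<psi> \<beta>\<close>, and \<open>a i \<beta>\<close> combines the Whittaker constant with
  the weight of K at \<nu>_i.\<close>

locale whittaker_functional = vector_space scl
  for scl :: "'k::field \<Rightarrow> 'w::ab_group_add \<Rightarrow> 'w" +
  fixes E F K K' :: "'i::finite \<Rightarrow> 'w \<Rightarrow> 'w"
    and one :: 'w
    and q :: "'i \<Rightarrow> 'k"
    and b :: "'i \<Rightarrow> 'i \<Rightarrow> 'k"
    and \<psi> :: "('i \<Rightarrow> nat) \<Rightarrow> 'w \<Rightarrow> 'k"
    and \<kappa> a :: "'i \<Rightarrow> ('i \<Rightarrow> nat) \<Rightarrow> 'k"
  assumes linear_E: "Vector_Spaces.linear scl scl (E i)"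
    and linear_F: "Vector_Spaces.linear scl scl (F i)"
    and linear_\<psi>: "Vector_Spaces.linear scl (*) (\<psi> \<beta>)"
    and E_F: "E i (F j y) = F j (E i y) +
      (if i = j then scl (inverse (q i - inverse (q i))) (K i y - K' i y) else 0)"
    and K_E: "K i (E j y) = scl (b i j) (E j (K i y))"
    and K'_E: "K' i (E j y) = scl (inverse (b i j)) (E j (K' i y))"
    and b_diag: "b i i = q i ^ 2"
    and b_nonzero: "b i j \<noteq> 0"
    and q_generic: "q i \<noteq> inverse (q i)"
    and E_one: "E i one = 0"
    and \<psi>_one: "\<psi> \<beta> one = (if \<beta> = (\<lambda>i. 0) then 1 else 0)"
    and \<psi>_K: "\<psi> \<beta> (K i y) = \<kappa> i \<beta> * \<psi> \<beta> y"
    and \<psi>_K': "\<psi> \<beta> (K' i y) = inverse (\<kappa> i \<beta>) * \<psi> \<beta> y"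
    and \<psi>_F: "\<psi> (\<beta>(i := Suc (\<beta> i))) (F i y) = a i \<beta> * \<psi> \<beta> y"
    and \<psi>_F_0: "\<beta> i = 0 \<Longrightarrow> \<psi> \<beta> (F i y) = 0"
begin

lemmas E_linear_simps =
  module_hom.add[OF linear_E[THEN Vector_Spaces.linear.axioms(3)]]
  module_hom.scale[OF linear_E[THEN Vector_Spaces.linear.axioms(3)]]
  module_hom.diff[OF linear_E[THEN Vector_Spaces.linear.axioms(3)]]
  module_hom.zero[OF linear_E[THEN Vector_Spaces.linear.axioms(3)]]

lemmas \<psi>_linear_simps =
  module_hom.add[OF linear_\<psi>[THEN Vector_Spaces.linear.axioms(3)]]
  module_hom.scale[OF linear_\<psi>[THEN Vector_Spaces.linear.axioms(3)]]
  module_hom.diff[OF linear_\<psi>[THEN Vector_Spaces.linear.axioms(3)]]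
  module_hom.zero[OF linear_\<psi>[THEN Vector_Spaces.linear.axioms(3)]]

section \<open>Ordered products of raising operators\<close>

definition E_prod :: "('i \<Rightarrow> nat) \<Rightarrow> 'i list \<Rightarrow> 'w \<Rightarrow> 'w" where
  "E_prod m is = foldr (\<lambda>i. E i ^^ m i) is"

lemma E_pow_linear:
  "(E i ^^ n) (x + y) = (E i ^^ n) x + (E i ^^ n) y"
  "(E i ^^ n) (scl c x) = scl c ((E i ^^ n) x)"
  "(E i ^^ n) (x - y) = (E i ^^ n) x - (E i ^^ n) y"
  by (induction n) (simp_all add: E_linear_simps)

lemma E_prod_linear:
  "E_prod m is (x + y) = E_prod m is x + E_prod m is y"
  "E_prod m is (scl c x) = scl c (E_prod m is x)"
  "E_prod m is (x - y) = E_prod m is x - E_prod m is y"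
  unfolding E_prod_def by (induction "is") (simp_all add: E_pow_linear)

lemma E_prod_append: "E_prod m (is @ js) y = E_prod m is (E_prod m js y)"
  by (simp add: E_prod_def)

lemma E_prod_Cons: "E_prod m (i # is) y = (E i ^^ m i) (E_prod m is y)"
  by (simp add: E_prod_def)

lemma E_prod_cong: "(\<And>i. i \<in> set is \<Longrightarrow> m i = m' i) \<Longrightarrow> E_prod m is y = E_prod m' is y"
  by (induction "is") (simp_all add: E_prod_def)

lemma K_E_pow: "K i ((E j ^^ n) y) = scl (b i j ^ n) ((E j ^^ n) (K i y))"
  by (induction n) (simp_all add: K_E E_linear_simps)

lemma K'_E_pow: "K' i ((E j ^^ n) y) = scl (inverse (b i j ^ n)) ((E j ^^ n) (K' i y))"
  by (induction n) (simp_all add: K'_E E_linear_simps field_simps b_nonzero)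

lemma q_nonzero: "q i \<noteq> 0"
  using q_generic[of i] by auto

lemma E_pow_F_other: "i \<noteq> j \<Longrightarrow> (E j ^^ n) (F i y) = F i ((E j ^^ n) y)"
  by (induction n) (simp_all add: E_F)

text \<open>Each of the n + 1 factors \<open>E i\<close> produces one Cartan term. Moving
  \<open>K i\<close> to the right past t remaining factors costs q^(2t), and 1 + q^2 + ... + q^(2n)
  equals q^n times the balanced q-integer of n + 1. For \<open>K' i\<close> the same holds with q
  inverted, and the q-integer is invariant under this.\<close>

lemma E_pow_F:
  "(E i ^^ Suc n) (F i y) = F i ((E i ^^ Suc n) y) +
     scl (qint (q i) (Suc n) / (q i - inverse (q i)))
       (scl (q i ^ n) ((E i ^^ n) (K i y)) - scl (inverse (q i ^ n)) ((E i ^^ n) (K' i y)))"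
proof (induction n)
  case 0
  have "qint (q i) 1 = 1"
    using q_generic[of i] by (simp add: qint_def)
  then show ?case by (simp add: E_F divide_inverse)
next
  case (Suc n)
  define d where "d = q i - inverse (q i)"
  define X where "X = (E i ^^ Suc n) (K i y)"
  define X' where "X' = (E i ^^ Suc n) (K' i y)"
  have d0: "d \<noteq> 0" using q_generic[of i] by (simp add: d_def)
  have d_q: "d * q i = q i ^ 2 - 1"
    using q_nonzero[of i] by (simp add: d_def left_diff_distrib power2_eq_square)
  have s: "qint (q i) k / d = (q i ^ k - inverse (q i ^ k)) / (d * d)" for k
    by (simp add: qint_def d_def power_inverse)
  define z where "z = q i ^ n"
  have z0: "z \<noteq> 0" using q_nonzero by (simp add: z_def)
  have pows: "q i ^ (2 * Suc n) = q i * q i * z * z" "q i ^ Suc (Suc n) = q i * q i * z"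
    "q i ^ Suc n = q i * z" "q i ^ n = z"
    by (simp_all add: z_def mult_2 power_add)
  have d_q': "d * q i = q i * q i - 1" using d_q by (simp add: power2_eq_square)
  \<comment> \<open>The geometric sum gains the term q^(2n+2), the cost of moving \<open>K i\<close>
    past \<open>E i ^^ Suc n\<close>; \<open>k2\<close> is its counterpart for
    \<open>K' i\<close>.\<close>
  have k1: "inverse d * q i ^ (2 * Suc n) + qint (q i) (Suc n) / d * q i ^ n
      = qint (q i) (Suc (Suc n)) / d * q i ^ Suc n"
  proof -
    have "inverse d * (q i * q i * z * z) + (q i * z - inverse (q i * z)) / (d * d) * z
        = (q i * z * z * (d * q i * q i) + (q i * q i * z * z - 1)) / (d * d * q i)"
      using d0 q_nonzero[of i] z0 by (simp add: field_simps)
    also have "q i * z * z * (d * q i * q i) = q i * q i * z * z * (q i * q i - 1)"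
      by (simp flip: d_q' add: mult_ac)
    also have "(\<dots> + (q i * q i * z * z - 1)) / (d * d * q i)
        = (q i * q i * z - inverse (q i * q i * z)) / (d * d) * (q i * z)"
      using d0 q_nonzero[of i] z0 by (simp add: field_simps)
    finally show ?thesis unfolding s pows .
  qed
  have k2: "inverse d * inverse (q i ^ (2 * Suc n)) + qint (q i) (Suc n) / d * inverse (q i ^ n)
      = qint (q i) (Suc (Suc n)) / d * inverse (q i ^ Suc n)"
  proof -
    have "inverse d * inverse (q i * q i * z * z) + (q i * z - inverse (q i * z)) / (d * d) * inverse z
        = (d * q i + q i * q i * (q i * q i * z * z - 1)) / (d * d * q i * q i * q i * z * z)"
      using d0 q_nonzero[of i] z0 by (simp add: field_simps)
    also have "\<dots> = (q i * q i * z - inverse (q i * q i * z)) / (d * d) * inverse (q i * z)"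
      unfolding d_q' using d0 q_nonzero[of i] z0 by (simp add: field_simps)
    finally show ?thesis unfolding s pows .
  qed
  have "(E i ^^ Suc (Suc n)) (F i y) = F i ((E i ^^ Suc (Suc n)) y)
      + (scl (inverse d) (K i ((E i ^^ Suc n) y) - K' i ((E i ^^ Suc n) y))
      + scl (qint (q i) (Suc n) / d) (scl (q i ^ n) X - scl (inverse (q i ^ n)) X'))"
    using Suc.IH by (simp add: E_F E_linear_simps d_def X_def X'_def)
  also have "scl (inverse d) (K i ((E i ^^ Suc n) y) - K' i ((E i ^^ Suc n) y))
      + scl (qint (q i) (Suc n) / d) (scl (q i ^ n) X - scl (inverse (q i ^ n)) X')
    = scl (inverse d * q i ^ (2 * Suc n) + qint (q i) (Suc n) / d * q i ^ n) X
      - scl (inverse d * inverse (q i ^ (2 * Suc n)) + qint (q i) (Suc n) / d * inverse (q i ^ n)) X'"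
    unfolding K_E_pow K'_E_pow b_diag X_def X'_def power_mult[symmetric]
    by (simp add: algebra_simps)
  finally show ?case
    unfolding k1 k2 by (simp add: X_def X'_def d_def scale_right_diff_distrib)
qed

lemma K_E_prod:
  "K i (E_prod m is y) = scl (\<Prod>j\<leftarrow>is. b i j ^ m j) (E_prod m is (K i y))"
  by (induction "is") (simp_all add: E_prod_def K_E_pow E_pow_linear mult_ac)

lemma K'_E_prod:
  "K' i (E_prod m is y) = scl (inverse (\<Prod>j\<leftarrow>is. b i j ^ m j)) (E_prod m is (K' i y))"
  by (induction "is") (simp_all add: E_prod_def K'_E_pow E_pow_linear mult_ac)

lemma prod_list_b_nonzero: "(\<Prod>j\<leftarrow>is. b i j ^ m j) \<noteq> 0"
  by (induction "is") (simp_all add: b_nonzero)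

lemma E_prod_F_other: "i \<notin> set is \<Longrightarrow> E_prod m is (F i y) = F i (E_prod m is y)"
  by (induction "is") (simp_all add: E_prod_def E_pow_F_other)

end

lemma finite_le_fun: "finite {m :: 'i::finite \<Rightarrow> nat. m \<le> \<beta>}"
proof -
  have "{m. m \<le> \<beta>} = (\<Pi>\<^sub>E i\<in>UNIV. {..\<beta> i})"
    by (auto simp: le_fun_def PiE_def extensional_def Pi_def)
  then show ?thesis by (simp add: finite_PiE)
qed

text \<open>
  The scalar \<open>H i \<gamma> m\<close> is what \<open>K i\<close> contributes, under \<open>\<psi> \<gamma>\<close>, when it is created inside the ordered
  product by commuting \<open>F i\<close> past the factor \<open>E i ^^ Suc (m i)\<close>; \<open>K' i\<close> contributes its inverse.
\<close>

locale whittaker_recursion = whittaker_functional scl E F K K' one q b \<psi> \<kappa> a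
  for scl :: "'k::field \<Rightarrow> 'w::ab_group_add \<Rightarrow> 'w"
    and E F K K' :: "'i::finite \<Rightarrow> 'w \<Rightarrow> 'w"
    and one q b \<psi> \<kappa> a +
  fixes before :: "'i \<Rightarrow> 'i \<Rightarrow> bool"
    and xs :: "'i list"
    and C :: "('i \<Rightarrow> nat) \<Rightarrow> ('i \<Rightarrow> nat) \<Rightarrow> 'k"
    and G :: "('i \<Rightarrow> nat) \<Rightarrow> 'k"
    and H :: "'i \<Rightarrow> ('i \<Rightarrow> nat) \<Rightarrow> ('i \<Rightarrow> nat) \<Rightarrow> 'k"
  assumes before_asym: "before i j \<Longrightarrow> \<not> before j i"
    and xs: "distinct xs" "set xs = UNIV" "sorted_wrt before xs"
    and C_0: "C \<beta> (\<lambda>i. 0) = 1"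
    and G_0: "G (\<lambda>i. 0) = 1"
    and G_nonzero: "G \<beta> \<noteq> 0"
    and H_eq: "H i \<gamma> m = \<kappa> i \<gamma> / (q i ^ m i * (\<Prod>j | before j i. b i j ^ m j))"
    and coefficients: "m \<le> \<delta> \<Longrightarrow>
      C (\<delta>(i := Suc (\<delta> i))) m * a i (\<delta> - m)
      + C (\<delta>(i := Suc (\<delta> i))) (m(i := Suc (m i)))
        * (qint (q i) (Suc (m i)) / (q i - inverse (q i)))
        * (H i (\<delta> - m) m - inverse (H i (\<delta> - m) m))
      = G (\<delta>(i := Suc (\<delta> i))) / G \<delta> * a i \<delta> * C \<delta> m"
begin

text \<open>\<open>F i\<close> commutes with every factor except the power of \<open>E i\<close>.
  The Cartan elements created there are moved left, through \<open>E i ^^ m i\<close> and all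
  factors standing before i, until \<open>\<psi>\<close> evaluates them outside the product. The
  price q^(-2 m_i) of this move, combined with q^(m_i) from \<open>E_pow_F\<close>, gives the power
  of q in \<open>H\<close>.\<close>

lemma \<psi>_E_prod_F:
  "\<psi> \<gamma> (E_prod (m(i := Suc (m i))) xs (F i y)) =
     \<psi> \<gamma> (F i (E_prod (m(i := Suc (m i))) xs y))
     + qint (q i) (Suc (m i)) / (q i - inverse (q i)) * (H i \<gamma> m - inverse (H i \<gamma> m))
       * \<psi> \<gamma> (E_prod m xs y)"
proof -
  obtain as bs where split: "xs = as @ i # bs"
    using xs(2) by (metis UNIV_I split_list)
  have notin: "i \<notin> set as" "i \<notin> set bs" using xs(1) split by auto
  have set_as: "set as = {j. before j i}"
    using xs(2,3) before_asym unfolding split sorted_wrt_append by auto (metis UNIV_I Un_iff insertCI insertE)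
  define B where "B = (\<Prod>j | before j i. b i j ^ m j)"
  have B: "B = (\<Prod>j\<leftarrow>as. b i j ^ m j)"
    using xs(1) unfolding split B_def set_as[symmetric] by (simp add: prod.distinct_set_conv_list)
  have B0: "B \<noteq> 0" unfolding B by (rule prod_list_b_nonzero)
  define s where "s = qint (q i) (Suc (m i)) / (q i - inverse (q i))"
  define m' where "m' = m(i := Suc (m i))"
  have as: "E_prod m' as z = E_prod m as z" and bs: "E_prod m' bs z = E_prod m bs z" for z
    unfolding m'_def using notin by (auto intro!: E_prod_cong)
  define z where "z = E_prod m bs y"
  have Py: "E_prod m xs y = E_prod m as ((E i ^^ m i) z)"
    unfolding split by (simp add: E_prod_append E_prod_Cons z_def)
  have "E_prod m' xs (F i y) = E_prod m as ((E i ^^ Suc (m i)) (F i z))"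
    unfolding split E_prod_append E_prod_Cons as bs z_def
    using notin by (simp add: E_prod_F_other m'_def)
  also have "\<dots> = F i (E_prod m as ((E i ^^ Suc (m i)) z)) +
     scl s (scl (q i ^ m i) (E_prod m as ((E i ^^ m i) (K i z)))
       - scl (inverse (q i ^ m i)) (E_prod m as ((E i ^^ m i) (K' i z))))"
    unfolding E_pow_F s_def[symmetric] E_prod_linear E_prod_F_other[OF notin(1)] ..
  also have "E_prod m as ((E i ^^ Suc (m i)) z) = E_prod m' xs y"
    unfolding split E_prod_append E_prod_Cons as bs z_def by (simp add: m'_def)
  also have "E_prod m as ((E i ^^ m i) (K i z)) = scl (inverse (B * q i ^ (2 * m i))) (K i (E_prod m xs y))"
    unfolding Py K_E_prod K_E_pow E_prod_linear b_diag B[symmetric] power_mult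
    using B0 q_nonzero[of i] by (simp add: field_simps)
  also have "E_prod m as ((E i ^^ m i) (K' i z)) = scl (B * q i ^ (2 * m i)) (K' i (E_prod m xs y))"
    unfolding Py K'_E_prod K'_E_pow E_prod_linear b_diag B[symmetric] power_mult
    using B0 q_nonzero[of i] by (simp add: field_simps)
  finally have expand: "\<psi> \<gamma> (E_prod m' xs (F i y)) = \<psi> \<gamma> (F i (E_prod m' xs y))
     + s * (q i ^ m i * (inverse (B * q i ^ (2 * m i)) * (\<kappa> i \<gamma> * \<psi> \<gamma> (E_prod m xs y)))
        - inverse (q i ^ m i) * (B * q i ^ (2 * m i) * (inverse (\<kappa> i \<gamma>) * \<psi> \<gamma> (E_prod m xs y))))"
    by (simp add: \<psi>_linear_simps \<psi>_K \<psi>_K')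
  have H1: "q i ^ m i * (inverse (B * q i ^ (2 * m i)) * (\<kappa> i \<gamma> * x)) = H i \<gamma> m * x" for x
    unfolding H_eq B_def[symmetric] mult_2 power_add using B0 q_nonzero[of i] by (simp add: field_simps)
  have H2: "inverse (q i ^ m i) * (B * q i ^ (2 * m i) * (inverse (\<kappa> i \<gamma>) * x)) = inverse (H i \<gamma> m) * x" for x
    unfolding H_eq B_def[symmetric] mult_2 power_add using B0 q_nonzero[of i] by (simp add: field_simps)
  show ?thesis
    unfolding m'_def[symmetric] s_def[symmetric] expand H1 H2 by (simp only: left_diff_distrib mult.assoc)
qed

lemma E_prod_F_zero:
  assumes "m i = 0"
  shows "E_prod m xs (F i y) = F i (E_prod m xs y)"
proof -
  obtain as bs where split: "xs = as @ i # bs"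
    using xs(2) by (metis UNIV_I split_list)
  have notin: "i \<notin> set as" "i \<notin> set bs" using xs(1) split by auto
  then show ?thesis
    unfolding split by (simp add: E_prod_append E_prod_Cons E_prod_F_other assms)
qed

text \<open>For a vector \<open>F i y\<close> both the part with \<open>F i\<close> moved left and
  the commutator part, once the latter is reindexed by m + \<alpha>_i, become multiples of the same
  values \<open>\<psi> (\<delta> - m) (E_prod m xs y)\<close>, where \<delta> = \<beta> -
  \<alpha>_i. Their sum is governed by \<open>coefficients\<close>, and what remains is the
  induction hypothesis at \<delta>.\<close>

theorem recursion:
  assumes "y \<in> F_span scl F one"
  shows "(\<Sum>m | m \<le> \<beta>. C \<beta> m * \<psi> (\<beta> - m) (E_prod m xs y)) = G \<beta> * \<psi> \<beta> y"
  using assms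
proof (induction y arbitrary: \<beta> rule: F_span.induct)
  case one
  have E_pow_zero: "(E i ^^ n) 0 = 0" for i n
    using E_pow_linear(2)[of n i 0 0] by simp
  have E_pow_one: "(E i ^^ n) one = (if n = 0 then one else 0)" for i n
    by (cases n) (simp_all add: funpow_Suc_right E_one E_pow_zero del: funpow.simps)
  have E_prod_one: "E_prod m is one = (if \<forall>i\<in>set is. m i = 0 then one else 0)" for m "is"
    by (induction "is") (auto simp: E_prod_def E_pow_one E_pow_zero)
  have "(\<Sum>m | m \<le> \<beta>. C \<beta> m * \<psi> (\<beta> - m) (E_prod m xs one))
      = (\<Sum>m | m \<le> \<beta>. if m = (\<lambda>i. 0) then \<psi> \<beta> one else 0)"
  proof (intro sum.cong refl)
    fix m
    show "C \<beta> m * \<psi> (\<beta> - m) (E_prod m xs one) = (if m = (\<lambda>i. 0) then \<psi> \<beta> one else 0)"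
    proof (cases "m = (\<lambda>i. 0)")
      case True
      have "\<beta> - (\<lambda>i. 0) = \<beta>" by (simp add: fun_eq_iff)
      with True show ?thesis by (simp add: E_prod_one C_0)
    next
      case False
      then have "\<not> (\<forall>i\<in>set xs. m i = 0)" using xs(2) by auto
      then have "E_prod m xs one = 0" unfolding E_prod_one by (rule if_not_P)
      with False show ?thesis by (simp add: \<psi>_linear_simps)
    qed
  qed
  also have "\<dots> = \<psi> \<beta> one"
    by (subst sum.delta[OF finite_le_fun]) (simp add: le_fun_def)
  also have "\<dots> = G \<beta> * \<psi> \<beta> one"
    by (simp add: \<psi>_one G_0)
  finally show ?case .
next
  case (add x y)
  then show ?case
    by (simp add: E_prod_linear \<psi>_linear_simps ring_distribs sum.distrib)
next
  case (scale x c)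
  have "(\<Sum>m | m \<le> \<beta>. C \<beta> m * \<psi> (\<beta> - m) (E_prod m xs (scl c x)))
      = c * (\<Sum>m | m \<le> \<beta>. C \<beta> m * \<psi> (\<beta> - m) (E_prod m xs x))"
    by (simp add: E_prod_linear \<psi>_linear_simps sum_distrib_left mult_ac)
  then show ?case
    unfolding scale.IH by (simp only: \<psi>_linear_simps mult.left_commute)
next
  case (F y i)
  show ?case
  proof (cases "\<beta> i")
    case 0
    have "C \<beta> m * \<psi> (\<beta> - m) (E_prod m xs (F i y)) = 0" if "m \<le> \<beta>" for m
    proof -
      have "m i = 0" using that 0 by (metis le_fun_def le_zero_eq)
      then show ?thesis using 0 by (simp add: E_prod_F_zero \<psi>_F_0)
    qed
    then have "(\<Sum>m | m \<le> \<beta>. C \<beta> m * \<psi> (\<beta> - m) (E_prod m xs (F i y))) = 0"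
      by (intro sum.neutral) blast
    then show ?thesis using 0 by (simp only: \<psi>_F_0 mult_zero_right)
  next
    case (Suc k)
    define \<delta> where "\<delta> = \<beta>(i := k)"
    have \<beta>: "\<beta> = \<delta>(i := Suc (\<delta> i))" using Suc by (auto simp: \<delta>_def)
    let ?up = "\<lambda>m. m(i := Suc (m i))"
    have inj_up: "inj_on ?up {m. m \<le> \<delta>}"
      by (rule inj_onI) (metis fun_upd_same fun_upd_triv fun_upd_upd nat.inject)
    have image_up: "?up ` {m. m \<le> \<delta>} = {m. m \<le> \<beta> \<and> m i \<noteq> 0}"
    proof (intro equalityI subsetI)
      fix m assume m: "m \<in> {m. m \<le> \<beta> \<and> m i \<noteq> 0}"
      then have "m = ?up (m(i := m i - 1))" by (auto simp: fun_eq_iff)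
      moreover have "m(i := m i - 1) \<le> \<delta>"
        using m by (auto simp: le_fun_def \<beta> split: if_splits)
      ultimately show "m \<in> ?up ` {m. m \<le> \<delta>}" by blast
    qed (auto simp: \<beta> le_fun_def)
    have diff_up: "\<beta> - ?up m = \<delta> - m" for m
      by (auto simp: fun_eq_iff \<beta>)
    define t where "t m = qint (q i) (Suc (m i)) / (q i - inverse (q i))
        * (H i (\<delta> - m) m - inverse (H i (\<delta> - m) m))" for m
    have "(\<Sum>m | m \<le> \<beta>. C \<beta> m * \<psi> (\<beta> - m) (E_prod m xs (F i y)))
       = (\<Sum>m | m \<le> \<beta>. C \<beta> m * \<psi> (\<beta> - m) (F i (E_prod m xs y)))
       + (\<Sum>m | m \<le> \<beta>. C \<beta> m * (\<psi> (\<beta> - m) (E_prod m xs (F i y)) - \<psi> (\<beta> - m) (F i (E_prod m xs y))))"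
      unfolding sum.distrib[symmetric] by (simp add: right_diff_distrib)
    \<comment> \<open>An index below \<beta> but not below \<delta> exhausts the coordinate i, so
      the functional at \<beta> - m annihilates the image of \<open>F i\<close>.\<close>
    also have "(\<Sum>m | m \<le> \<beta>. C \<beta> m * \<psi> (\<beta> - m) (F i (E_prod m xs y)))
        = (\<Sum>m | m \<le> \<delta>. C \<beta> m * \<psi> (\<beta> - m) (F i (E_prod m xs y)))"
    proof (rule sum.mono_neutral_right)
      show "finite {m. m \<le> \<beta>}" by (rule finite_le_fun)
      show "{m. m \<le> \<delta>} \<subseteq> {m. m \<le> \<beta>}" by (auto simp: \<beta> le_fun_def) (metis le_SucI)
      show "\<forall>m\<in>{m. m \<le> \<beta>} - {m. m \<le> \<delta>}. C \<beta> m * \<psi> (\<beta> - m) (F i (E_prod m xs y)) = 0"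
      proof
        fix m assume "m \<in> {m. m \<le> \<beta>} - {m. m \<le> \<delta>}"
        then have le: "m \<le> \<beta>" and nle: "\<not> m \<le> \<delta>" by auto
        from nle obtain j where "\<delta> j < m j" by (auto simp: le_fun_def not_le)
        moreover have "m j \<le> \<beta> j" using le by (simp add: le_fun_def)
        ultimately have "(\<beta> - m) i = 0" by (auto simp: \<beta> split: if_splits)
        then show "C \<beta> m * \<psi> (\<beta> - m) (F i (E_prod m xs y)) = 0" by (simp add: \<psi>_F_0)
      qed
    qed
    also have "\<dots> = (\<Sum>m | m \<le> \<delta>. C \<beta> m * a i (\<delta> - m) * \<psi> (\<delta> - m) (E_prod m xs y))"
    proof (intro sum.cong refl)
      fix m assume "m \<in> {m. m \<le> \<delta>}"
      then have "m j \<le> \<delta> j" for j by (simp add: le_fun_def)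
      then have "\<beta> - m = ?up (\<delta> - m)" by (auto simp: fun_eq_iff \<beta> Suc_diff_le)
      then show "C \<beta> m * \<psi> (\<beta> - m) (F i (E_prod m xs y)) = C \<beta> m * a i (\<delta> - m) * \<psi> (\<delta> - m) (E_prod m xs y)"
        by (simp only: \<psi>_F mult.assoc)
    qed
    \<comment> \<open>Without a factor \<open>E i\<close> there is no commutator, so only indices of
      the form m + \<alpha>_i contribute.\<close>
    also have "(\<Sum>m | m \<le> \<beta>. C \<beta> m * (\<psi> (\<beta> - m) (E_prod m xs (F i y)) - \<psi> (\<beta> - m) (F i (E_prod m xs y))))
       = (\<Sum>m\<in>?up ` {m. m \<le> \<delta>}. C \<beta> m * (\<psi> (\<beta> - m) (E_prod m xs (F i y)) - \<psi> (\<beta> - m) (F i (E_prod m xs y))))"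
      unfolding image_up using finite_le_fun[of \<beta>]
      by (intro sum.mono_neutral_right) (auto simp: E_prod_F_zero)
    also have "\<dots> = (\<Sum>m | m \<le> \<delta>. C \<beta> (?up m) * t m * \<psi> (\<delta> - m) (E_prod m xs y))"
      unfolding sum.reindex[OF inj_up] o_def diff_up \<psi>_E_prod_F t_def by (simp add: mult.assoc)
    also have "(\<Sum>m | m \<le> \<delta>. C \<beta> m * a i (\<delta> - m) * \<psi> (\<delta> - m) (E_prod m xs y)) + \<dots>
      = (\<Sum>m | m \<le> \<delta>. (C \<beta> m * a i (\<delta> - m) + C \<beta> (?up m) * t m) * \<psi> (\<delta> - m) (E_prod m xs y))"
      by (simp add: sum.distrib ring_distribs)
    also have "\<dots> = (\<Sum>m | m \<le> \<delta>. G \<beta> / G \<delta> * a i \<delta> * (C \<delta> m * \<psi> (\<delta> - m) (E_prod m xs y)))"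
    proof (intro sum.cong refl)
      fix m assume "m \<in> {m. m \<le> \<delta>}"
      then have "C \<beta> m * a i (\<delta> - m) + C \<beta> (?up m) * t m = G \<beta> / G \<delta> * a i \<delta> * C \<delta> m"
        using coefficients[of m \<delta> i] unfolding \<beta>[symmetric] t_def by (simp add: mult.assoc)
      then show "(C \<beta> m * a i (\<delta> - m) + C \<beta> (?up m) * t m) * \<psi> (\<delta> - m) (E_prod m xs y)
          = G \<beta> / G \<delta> * a i \<delta> * (C \<delta> m * \<psi> (\<delta> - m) (E_prod m xs y))"
        by (simp add: mult.assoc)
    qed
    also have "\<dots> = G \<beta> / G \<delta> * a i \<delta> * (G \<delta> * \<psi> \<delta> y)"
      unfolding sum_distrib_left[symmetric] F.IH ..
    also have "\<dots> = G \<beta> * \<psi> \<beta> (F i y)"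
      unfolding \<beta> \<psi>_F using G_nonzero[of \<delta>] by simp
    finally show ?thesis .
  qed
qed

end

section \<open>The weight lattice and powers of \<open>v\<close>\<close>

lemma kvar_power: "kvar x ^ k = Fract (Poly_Mapping.single (Poly_Mapping.single x k) 1) 1"
proof (induction k)
  case 0
  show ?case by (simp add: One_fract_def)
next
  case (Suc k)
  then show ?case
    by (simp add: kvar_def mult_single single_add[symmetric])
qed

lemma kvar_nonzero: "kvar x \<noteq> 0"
proof
  assume "kvar x = 0"
  then have "Poly_Mapping.single (Poly_Mapping.single x 1) 1 = (0 :: ('a option \<Rightarrow>\<^sub>0 nat) \<Rightarrow>\<^sub>0 complex)"
    by (simp add: kvar_def eq_fract Zero_fract_def)
  then show False by (metis lookup_single_eq lookup_zero zero_neq_one)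
qed

text \<open>Monomials with different exponents have different supports, and polynomials embed into
  their fraction field. Hence v has infinite order, which is the source of the genericity of q and
  of the separation of weights below.\<close>

lemma kvar_power_eq_1: "kvar x ^ k = 1 \<longleftrightarrow> k = 0"
proof
  assume "kvar x ^ k = 1"
  then have "Poly_Mapping.single (Poly_Mapping.single x k) 1 = (1 :: ('a option \<Rightarrow>\<^sub>0 nat) \<Rightarrow>\<^sub>0 complex)"
    unfolding kvar_power by (simp add: One_fract_def eq_fract)
  then have "Poly_Mapping.keys (Poly_Mapping.single (Poly_Mapping.single x k) (1::complex)) = {0}"
    by simp
  then have "Poly_Mapping.single x k = 0" by simp
  then show "k = 0" by (metis lookup_single_eq lookup_zero)
qed simp

lemma kvar_powi_eq_1: "kvar x powi k = 1 \<longleftrightarrow> k = 0"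
  by (cases k rule: int_cases2) (auto simp: power_int_minus kvar_power_eq_1)

locale root_data =
  fixes \<Delta> :: "'e::euclidean_space set" and \<alpha> :: "'i::{finite,linorder} \<Rightarrow> 'e" and N :: nat
  assumes root_system: "root_system \<Delta>"
    and simple_roots: "simple_roots \<Delta> \<alpha>"
    and N_pos: "N > 0"
    and N_integral: "real N * (pvec \<alpha> \<mu> \<bullet> pvec \<alpha> \<mu>') \<in> \<int>"
begin

lemma \<alpha>_in_roots: "\<alpha> i \<in> \<Delta>"
  using simple_roots by (auto simp: simple_roots_def)

lemma \<alpha>_inner_pos: "\<alpha> i \<bullet> \<alpha> i > 0"
  using \<alpha>_in_roots[of i] root_system by (auto simp: root_system_def)

lemma dd_pos: "dd \<alpha> i > 0"
  using \<alpha>_inner_pos by (simp add: dd_def)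

lemma span_\<alpha>: "span (range \<alpha>) = UNIV"
proof -
  have "qvec \<alpha> m \<in> span (range \<alpha>)" for m
    unfolding qvec_def by (intro span_sum span_scale span_base) auto
  then have "\<Delta> \<subseteq> span (range \<alpha>)"
    using simple_roots unfolding simple_roots_def by (metis span_neg subsetI)
  then have "span \<Delta> \<subseteq> span (range \<alpha>)"
    by (metis span_mono span_span)
  then show ?thesis
    using root_system by (auto simp: root_system_def)
qed

lemma eq_if_inner_\<alpha>_eq:
  assumes "\<And>j. x \<bullet> \<alpha> j = y \<bullet> \<alpha> j"
  shows "x = y"
proof -
  have "(x - y) \<bullet> z = 0" for z
  proof -
    have "z \<in> span (range \<alpha>)" by (simp add: span_\<alpha>)
    then show ?thesis
      by (induction rule: span_induct_alt) (auto simp: inner_right_distrib inner_diff_left assms)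
  qed
  from this[of "x - y"] show ?thesis by simp
qed

text \<open>The definite description needs both existence, from the independence of the simple
  roots, and uniqueness, because they span.\<close>

lemma fund_weight_inner: "fund_weight \<alpha> i \<bullet> \<alpha> j = (if j = i then dd \<alpha> j else 0)"
proof -
  let ?Q = "\<lambda>x. \<forall>j. 2 * (x \<bullet> \<alpha> j) / (\<alpha> j \<bullet> \<alpha> j) = (if j = i then 1 else 0)"
  have Q: "?Q x \<longleftrightarrow> (\<forall>j. x \<bullet> \<alpha> j = (if j = i then dd \<alpha> j else 0))" for x
    using \<alpha>_inner_pos by (auto simp: dd_def field_simps less_le)
  have inj: "inj \<alpha>" and ind: "independent (range \<alpha>)"
    using simple_roots by (auto simp: simple_roots_def)
  obtain f :: "'e \<Rightarrow> real" where f: "linear f"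
      "\<And>x. x \<in> range \<alpha> \<Longrightarrow> f x = (if x = \<alpha> i then dd \<alpha> i else 0)"
    using linear_independent_extend[OF ind, of "\<lambda>x. if x = \<alpha> i then dd \<alpha> i else 0"] by blast
  \<comment> \<open>\<open>adjoint f 1\<close> is the vector representing the functional f through
    the inner product.\<close>
  have "adjoint f 1 \<bullet> y = f y" for y
    using adjoint_works[OF f(1), of y 1] by (simp add: inner_commute)
  then have ex: "?Q (adjoint f 1)"
    unfolding Q using f(2) inj by (auto simp: inj_eq)
  have "?Q (fund_weight \<alpha> i)"
    unfolding fund_weight_def
    by (rule theI[of ?Q, OF ex]) (rule eq_if_inner_\<alpha>_eq, use ex in \<open>auto simp: Q\<close>)
  then show ?thesis unfolding Q by blast
qed

lemma pvec_inner_\<alpha>: "pvec \<alpha> \<mu> \<bullet> \<alpha> j = of_int (\<mu> j) * dd \<alpha> j"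
  by (simp add: pvec_def inner_sum_left fund_weight_inner if_distrib[of "(*) _"] cong: if_cong)

lemma cartan_dd: "of_int (cartan \<alpha> i j) * dd \<alpha> i = \<alpha> i \<bullet> \<alpha> j"
proof -
  have "2 * (\<alpha> i \<bullet> \<alpha> j) / (\<alpha> i \<bullet> \<alpha> i) \<in> \<int>"
    using root_system \<alpha>_in_roots by (auto simp: root_system_def)
  then have "of_int (cartan \<alpha> i j) = 2 * (\<alpha> i \<bullet> \<alpha> j) / (\<alpha> i \<bullet> \<alpha> i)"
    by (simp add: cartan_def)
  then show ?thesis using \<alpha>_inner_pos[of i] by (simp add: dd_def)
qed

lemma pvec_cartan: "pvec \<alpha> (\<lambda>j. cartan \<alpha> j i) = \<alpha> i"
  by (rule eq_if_inner_\<alpha>_eq) (simp add: pvec_inner_\<alpha> cartan_dd inner_commute[of "\<alpha> i"])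

lemma weyl_vector_inner: "weyl_vector \<alpha> \<bullet> \<alpha> i = dd \<alpha> i"
  by (simp add: weyl_vector_def inner_sum_left fund_weight_inner)

definition weights :: "'e set" where
  "weights = range (pvec \<alpha>)"

lemma coroot_pairing: "2 * (x \<bullet> \<alpha> i) / (\<alpha> i \<bullet> \<alpha> i) = (x \<bullet> \<alpha> i) / dd \<alpha> i"
  by (simp add: dd_def)

text \<open>Integrality on coroots describes P without coordinates, so that closure of P under the
  group operations is immediate and the simple roots can be treated as weights.\<close>

lemma weights_iff: "x \<in> weights \<longleftrightarrow> (\<forall>i. (x \<bullet> \<alpha> i) / dd \<alpha> i \<in> \<int>)"
proof
  assume "x \<in> weights"
  then show "\<forall>i. (x \<bullet> \<alpha> i) / dd \<alpha> i \<in> \<int>"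
    using dd_pos by (auto simp: weights_def pvec_inner_\<alpha> less_le)
next
  assume *: "\<forall>i. (x \<bullet> \<alpha> i) / dd \<alpha> i \<in> \<int>"
  have "x = pvec \<alpha> (\<lambda>i. \<lfloor>(x \<bullet> \<alpha> i) / dd \<alpha> i\<rfloor>)"
  proof (rule eq_if_inner_\<alpha>_eq)
    fix j
    have floor: "of_int \<lfloor>(x \<bullet> \<alpha> j) / dd \<alpha> j\<rfloor> = (x \<bullet> \<alpha> j) / dd \<alpha> j"
      using * by simp
    show "x \<bullet> \<alpha> j = pvec \<alpha> (\<lambda>i. \<lfloor>(x \<bullet> \<alpha> i) / dd \<alpha> i\<rfloor>) \<bullet> \<alpha> j"
      unfolding pvec_inner_\<alpha> floor using dd_pos[of j] by simp
  qed
  then show "x \<in> weights" by (auto simp: weights_def)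
qed

lemma weights_intros:
  "0 \<in> weights"
  "x \<in> weights \<Longrightarrow> y \<in> weights \<Longrightarrow> x + y \<in> weights"
  "x \<in> weights \<Longrightarrow> y \<in> weights \<Longrightarrow> x - y \<in> weights"
  "x \<in> weights \<Longrightarrow> - x \<in> weights"
  "r \<in> \<int> \<Longrightarrow> x \<in> weights \<Longrightarrow> r *\<^sub>R x \<in> weights"
  "pvec \<alpha> \<mu> \<in> weights"
  "\<alpha> i \<in> weights"
proof -
  show "pvec \<alpha> \<mu> \<in> weights" by (simp add: weights_def)
  show "\<alpha> i \<in> weights" using pvec_cartan[of i] by (metis weights_def rangeI)
  show "r \<in> \<int> \<Longrightarrow> x \<in> weights \<Longrightarrow> r *\<^sub>R x \<in> weights"
    unfolding weights_iff by (auto simp: times_divide_eq_right[symmetric] simp del: times_divide_eq_right)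
qed (auto simp: weights_iff inner_add_left inner_diff_left add_divide_distrib diff_divide_distrib)

lemma weights_sum: "(\<And>i. i \<in> A \<Longrightarrow> f i \<in> weights) \<Longrightarrow> sum f A \<in> weights"
  by (induction A rule: infinite_finite_induct) (auto intro: weights_intros)

lemma qvec_in_weights: "qvec \<alpha> m \<in> weights"
  unfolding qvec_def by (intro weights_sum weights_intros) auto

lemma fund_weight_eq_pvec: "fund_weight \<alpha> i = pvec \<alpha> (\<lambda>j. if j = i then 1 else 0)"
  by (rule eq_if_inner_\<alpha>_eq) (simp add: pvec_inner_\<alpha> fund_weight_inner)

lemma weyl_vector_in_weights: "weyl_vector \<alpha> \<in> weights"
  unfolding weyl_vector_def fund_weight_eq_pvec by (intro weights_sum weights_intros)

lemma N_inner: "x \<in> weights \<Longrightarrow> y \<in> weights \<Longrightarrow> real N * (x \<bullet> y) \<in> \<int>"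
  using N_integral by (auto simp: weights_def)

text \<open>Here d_i is half of (\<alpha>_i, \<alpha>_i), but it is also the pairing of the weights
  \<omega>_i and \<alpha>_i, so no factor 2 is lost.\<close>

lemma N_dd: "real N * dd \<alpha> i \<in> \<int>"
  using N_inner[of "fund_weight \<alpha> i" "\<alpha> i"]
  by (simp add: fund_weight_inner fund_weight_eq_pvec[symmetric] weights_intros(7)
      weights_intros(6)[of "\<lambda>j. if j = i then 1 else 0", folded fund_weight_eq_pvec])

text \<open>Needed for the exponent -(\<beta>, \<beta>)/2 in the normalization of J. Adding one
  simple root at a time, the cross terms occur twice and absorb the factor 1/2, while the squares
  contribute multiples of d_i.\<close>

lemma N_half_norm: "real N * (qvec \<alpha> m \<bullet> qvec \<alpha> m / 2) \<in> \<int>"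
proof -
  define s where "s A = (\<Sum>i\<in>A. real (m i) *\<^sub>R \<alpha> i)" for A
  have s_weight: "s A \<in> weights" for A
    unfolding s_def by (intro weights_sum weights_intros) auto
  have "real N * (s A \<bullet> s A / 2) \<in> \<int>" if "finite A" for A
    using that
  proof (induction A)
    case empty
    show ?case by (simp add: s_def)
  next
    case (insert i A)
    have "s (insert i A) = s A + real (m i) *\<^sub>R \<alpha> i"
      using insert by (simp add: s_def)
    then have "real N * (s (insert i A) \<bullet> s (insert i A) / 2) =
        real N * (s A \<bullet> s A / 2) + real (m i) * (real N * (s A \<bullet> \<alpha> i)) + real (m i) * (real (m i) * (real N * dd \<alpha> i))"
      by (simp add: inner_add_left inner_add_right dd_def inner_commute algebra_simps add_divide_distrib)
    moreover have "real (m i) * (real N * (s A \<bullet> \<alpha> i)) \<in> \<int>"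
      by (intro Ints_mult[of "real (m i)"] N_inner s_weight weights_intros) simp
    moreover have "real (m i) * (real (m i) * (real N * dd \<alpha> i)) \<in> \<int>"
      by (intro Ints_mult[of "real (m i)"] N_dd) simp_all
    ultimately show ?case
      using insert.IH by (metis Ints_add)
  qed
  from this[of UNIV] show ?thesis by (simp add: s_def qvec_def)
qed

section \<open>Integral exponents and the character \<open>ev\<close>\<close>

definition lattice :: "('e \<times> real) set" where
  "lattice = {x. fst x \<in> weights \<and> real N * snd x \<in> \<int>}"

lemma lattice_intros:
  "0 \<in> lattice"
  "x \<in> lattice \<Longrightarrow> y \<in> lattice \<Longrightarrow> x + y \<in> lattice"
  "x \<in> lattice \<Longrightarrow> y \<in> lattice \<Longrightarrow> x - y \<in> lattice"
  "x \<in> lattice \<Longrightarrow> - x \<in> lattice"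
  "r \<in> \<int> \<Longrightarrow> x \<in> lattice \<Longrightarrow> r *\<^sub>R x \<in> lattice"
  "real N * r \<in> \<int> \<Longrightarrow> num r \<in> lattice"
  "\<xi> \<in> weights \<Longrightarrow> \<mu> \<in> weights \<Longrightarrow> lam_pair \<xi> \<mu> \<in> lattice"
  by (auto simp: lattice_def num_def lam_pair_def ring_distribs mult.left_commute[of "real N"]
      intro!: weights_intros N_inner)

lemma lattice_sum: "(\<And>i. i \<in> A \<Longrightarrow> f i \<in> lattice) \<Longrightarrow> sum f A \<in> lattice"
  by (induction A rule: infinite_finite_induct) (auto intro: lattice_intros)

definition ev :: "'e \<times> real \<Rightarrow> 'i kfield" where
  "ev = vexp \<alpha> N vroot uvar"

lemma vroot_nonzero: "vroot \<noteq> 0" and uvar_nonzero: "uvar i \<noteq> 0"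
  by (simp_all add: vroot_def uvar_def kvar_nonzero)

lemma ev_nonzero: "ev x \<noteq> 0"
  by (simp add: ev_def vexp_def vpow_def power_int_eq_0_iff vroot_nonzero uvar_nonzero)

lemma vexp_inverse: "vexp \<alpha> N (inverse vroot) (\<lambda>i. inverse (uvar i)) x = inverse (ev x)"
  by (simp add: ev_def vexp_def vpow_def power_int_inverse prod_inversef[symmetric] o_def)

lemma floor_add_Ints: "x \<in> \<int> \<Longrightarrow> \<lfloor>x + y\<rfloor> = \<lfloor>x\<rfloor> + \<lfloor>y :: real\<rfloor>"
  by (auto elim!: Ints_cases)

text \<open>For exponents in \<open>lattice\<close> all floors are exact; for general real exponents
  floors are not additive. This is why membership in \<open>lattice\<close> accompanies every later
  computation with \<open>ev\<close>.\<close>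

lemma ev_add:
  assumes "x \<in> lattice" "y \<in> lattice"
  shows "ev (x + y) = ev x * ev y"
proof -
  have "vpow N vroot (snd (x + y)) = (vpow N vroot (snd x) * vpow N vroot (snd y) :: 'i kfield)"
    using assms by (simp add: vpow_def lattice_def ring_distribs floor_add_Ints power_int_add vroot_nonzero)
  moreover have "uvar i powi \<lfloor>(fst (x + y) \<bullet> \<alpha> i) / dd \<alpha> i\<rfloor> =
     uvar i powi \<lfloor>(fst x \<bullet> \<alpha> i) / dd \<alpha> i\<rfloor> * uvar i powi \<lfloor>(fst y \<bullet> \<alpha> i) / dd \<alpha> i\<rfloor>" for i
    using assms by (simp add: lattice_def weights_iff inner_add_left add_divide_distrib
        floor_add_Ints power_int_add uvar_nonzero)
  ultimately show ?thesis
    unfolding ev_def vexp_def coroot_pairing by (simp only: prod.distrib mult_ac)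
qed

lemma ev_0: "ev 0 = 1"
  by (simp add: ev_def vexp_def vpow_def)

lemma ev_minus: "x \<in> lattice \<Longrightarrow> ev (- x) = inverse (ev x)"
  using ev_add[of x "- x"] ev_nonzero[of x]
  by (simp add: lattice_intros ev_0 inverse_unique)

lemma ev_diff: "x \<in> lattice \<Longrightarrow> y \<in> lattice \<Longrightarrow> ev (x - y) = ev x / ev y"
  using ev_add[of x "- y"] by (simp add: lattice_intros ev_minus divide_inverse)

lemma ev_of_nat: "x \<in> lattice \<Longrightarrow> ev (real k *\<^sub>R x) = ev x ^ k"
  by (induction k) (simp_all add: ev_0 scaleR_left_distrib ev_add lattice_intros)

lemma ev_num_eq_1:
  assumes "real N * r \<in> \<int>" "ev (num r) = 1"
  shows "r = 0"
proof -
  have "vroot powi \<lfloor>real N * r\<rfloor> = (1 :: 'i kfield)"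
    using assms(2) by (simp add: ev_def vexp_def vpow_def num_def)
  then have "\<lfloor>real N * r\<rfloor> = 0" by (simp add: vroot_def kvar_powi_eq_1)
  then show ?thesis using assms(1) N_pos by (auto elim!: Ints_cases)
qed

lemma num_in_lattice:
  "num (dd \<alpha> i) \<in> lattice"
  "x \<in> weights \<Longrightarrow> y \<in> weights \<Longrightarrow> num (x \<bullet> y) \<in> lattice"
  "num (qvec \<alpha> m \<bullet> qvec \<alpha> m / 2) \<in> lattice"
  by (simp_all add: lattice_intros N_dd N_inner N_half_norm del: times_divide_eq_right)

lemma vi_eq: "vi \<alpha> N vroot i = ev (num (dd \<alpha> i))"
  by (simp add: vi_def ev_def vexp_def num_def)

lemma vpow_eq: "vpow N vroot r = ev (num r)"
  by (simp add: ev_def vexp_def num_def)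

lemma vpow_inverse: "vpow N (inverse vroot) r = inverse (ev (num r))"
  by (simp add: vpow_eq[symmetric] vpow_def power_int_inverse)

lemma vi_inverse: "vi \<alpha> N (inverse vroot) i = inverse (vi \<alpha> N vroot i)"
  by (simp add: vi_def vpow_def power_int_inverse)

lemma pvec_uminus: "pvec \<alpha> (\<lambda>j. - \<mu> j) = - pvec \<alpha> \<mu>"
  by (rule eq_if_inner_\<alpha>_eq) (simp add: pvec_inner_\<alpha>)

lemma lam_pair_uminus: "lam_pair \<xi> (- \<mu>) = - lam_pair \<xi> \<mu>"
  by (simp add: lam_pair_def)

lemma ev_num_uminus: "num r \<in> lattice \<Longrightarrow> ev (num (- r)) = inverse (ev (num r))"
  using ev_minus[of "num r"] by (simp add: num_def)

lemma lam_pair_lattice: "lam_pair (- qvec \<alpha> \<beta>) (pvec \<alpha> \<mu>) \<in> lattice"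
  by (intro lattice_intros qvec_in_weights weights_intros)

end

section \<open>Exponents of the Casimir recursion\<close>

lemma qvec_Suc: "qvec \<alpha> (m(i := Suc (m i))) = qvec \<alpha> m + \<alpha> i"
proof -
  have "qvec \<alpha> (m(i := Suc (m i))) = (\<Sum>j\<in>UNIV. real (m j) *\<^sub>R \<alpha> j + (if j = i then \<alpha> j else 0))"
    unfolding qvec_def by (intro sum.cong refl) (simp add: scaleR_left_distrib)
  then show ?thesis by (simp add: sum.distrib qvec_def)
qed

lemma qvec_diff: "m \<le> \<beta> \<Longrightarrow> qvec \<alpha> (\<beta> - m) = qvec \<alpha> \<beta> - qvec \<alpha> m"
  by (simp add: qvec_def le_fun_def of_nat_diff scaleR_left_diff_distrib sum_subtractf)

lemma qvec_inner: "qvec \<alpha> m \<bullet> x = (\<Sum>j\<in>UNIV. real (m j) * (\<alpha> j \<bullet> x))"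
  by (simp add: qvec_def inner_sum_left)

definition quadratic :: "('i::finite \<Rightarrow> 'i \<Rightarrow> real) \<Rightarrow> ('i \<Rightarrow> real) \<Rightarrow> real" where
  "quadratic B f = (\<Sum>i\<in>UNIV. \<Sum>j\<in>UNIV. f i * f j * B i j)"

text \<open>The exact Taylor expansion in one coordinate. The form is not assumed symmetric, since
  it will be triangular with respect to an ordering; hence both \<open>B i j\<close> and
  \<open>B j i\<close> occur.\<close>

lemma quadratic_upd:
  "quadratic B (f(i := f i + k)) =
     quadratic B f + k * (\<Sum>j\<in>UNIV. f j * (B i j + B j i)) + k * k * B i i"
proof -
  define e where "e j = (if j = i then k else 0)" for j
  have f: "(f(i := f i + k)) = (\<lambda>j. f j + e j)" by (auto simp: e_def)
  have if_mult: "(if P then k else 0) * x = (if P then k * x else 0)"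
    "x * (if P then k else 0) = (if P then k * x else 0)" for P and x :: real
    by simp_all
  have "quadratic B (\<lambda>j. f j + e j) = quadratic B f + (\<Sum>a\<in>UNIV. \<Sum>j\<in>UNIV. e a * (f j * B a j))
      + (\<Sum>a\<in>UNIV. \<Sum>j\<in>UNIV. e j * (f a * B a j)) + (\<Sum>a\<in>UNIV. \<Sum>j\<in>UNIV. e a * (e j * B a j))"
    by (simp add: quadratic_def sum.distrib[symmetric] algebra_simps)
  also have "(\<Sum>a\<in>UNIV. \<Sum>j\<in>UNIV. e a * (f j * B a j)) = k * (\<Sum>j\<in>UNIV. f j * B i j)"
    unfolding sum_distrib_left[symmetric] by (simp add: e_def if_mult)
  also have "(\<Sum>a\<in>UNIV. \<Sum>j\<in>UNIV. e j * (f a * B a j)) = k * (\<Sum>j\<in>UNIV. f j * B j i)"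
    by (simp add: e_def if_mult sum_distrib_left)
  also have "(\<Sum>a\<in>UNIV. \<Sum>j\<in>UNIV. e a * (e j * B a j)) = k * k * B i i"
    unfolding sum_distrib_left[symmetric] by (simp add: e_def if_mult)
  finally show ?thesis
    by (simp add: f sum.distrib ring_distribs)
qed

locale casimir_exponents = root_data \<Delta> \<alpha> N
  for \<Delta> :: "'e::euclidean_space set" and \<alpha> :: "'i::{finite,linorder} \<Rightarrow> 'e" and N +
  fixes \<epsilon> n n' :: "'i \<Rightarrow> 'i \<Rightarrow> int" and c c' :: "'i \<Rightarrow> 'i kfield" and prec :: "'e \<Rightarrow> 'e \<Rightarrow> bool"
  assumes triple: "sevostyanov_triple \<alpha> \<epsilon> n c"
    and convex: "convex_ordering \<Delta> \<alpha> prec"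
    and adapted: "\<epsilon> i j = -1 \<Longrightarrow> prec (\<alpha> i) (\<alpha> j)"
begin

text \<open>In the ordered products, larger roots stand to the left.\<close>

definition before :: "'i \<Rightarrow> 'i \<Rightarrow> bool" where
  "before i j \<longleftrightarrow> prec (\<alpha> j) (\<alpha> i)"

lemma \<alpha>_positive: "\<alpha> i \<in> positive_roots \<Delta> \<alpha>"
proof -
  have "\<alpha> i = qvec \<alpha> ((\<lambda>j. 0)(i := Suc 0))"
    using qvec_Suc[of \<alpha> "\<lambda>j. 0" i] by (simp add: qvec_def[of \<alpha> "\<lambda>j. 0"])
  then show ?thesis using \<alpha>_in_roots unfolding positive_roots_def by blast
qed

lemma \<alpha>_eq_iff: "\<alpha> i = \<alpha> j \<longleftrightarrow> i = j"
  using simple_roots by (auto simp: simple_roots_def inj_eq)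

lemma before_irrefl: "\<not> before i i"
  and before_trans: "before i j \<Longrightarrow> before j k \<Longrightarrow> before i k"
  and before_total: "i \<noteq> j \<Longrightarrow> before i j \<or> before j i"
  using convex \<alpha>_positive unfolding convex_ordering_def before_def by (metis \<alpha>_eq_iff)+

lemma before_asym: "before i j \<Longrightarrow> \<not> before j i"
  using before_irrefl before_trans by blast

abbreviation \<nu> :: "'i \<Rightarrow> 'e" where "\<nu> i \<equiv> pvec \<alpha> (n i)"

abbreviation \<nu>' :: "'i \<Rightarrow> 'e" where "\<nu>' i \<equiv> pvec \<alpha> (n' i)"

text \<open>Since (\<nu>_i, \<alpha>_j) = d_j n_ij, this is Sevostyanov's condition once the sign is
  known: \<open>adapted\<close> excludes -1 because \<open>before\<close> reverses
  \<open>prec\<close>. For orthogonal roots both sides vanish whatever the sign.\<close>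

lemma \<nu>_inner_skew: "before i j \<Longrightarrow> \<nu> i \<bullet> \<alpha> j - \<nu> j \<bullet> \<alpha> i = \<alpha> i \<bullet> \<alpha> j"
proof -
  assume before: "before i j"
  have "\<nu> i \<bullet> \<alpha> j - \<nu> j \<bullet> \<alpha> i = of_int (\<epsilon> i j) * (\<alpha> i \<bullet> \<alpha> j)"
    using triple by (simp add: sevostyanov_triple_def pvec_inner_\<alpha> mult.commute)
  moreover have "\<epsilon> i j = 1" if "\<alpha> i \<bullet> \<alpha> j \<noteq> 0"
  proof -
    have "cartan \<alpha> i j \<noteq> 0" using cartan_dd[of i j] that by auto
    moreover have "i \<noteq> j" using before before_irrefl by blast
    ultimately have "\<epsilon> i j \<in> {1, -1}"
      using triple unfolding sevostyanov_triple_def orientation_matrix_def by metis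
    moreover have "\<epsilon> i j \<noteq> -1"
      using adapted[of i j] before before_asym[of j i] by (auto simp: before_def)
    ultimately show ?thesis by simp
  qed
  ultimately show ?thesis by (cases "\<alpha> i \<bullet> \<alpha> j = 0") auto
qed

text \<open>The exponent collected by K at \<alpha>_i on its way out of the ordered product, through
  the factors to the left of E_i.\<close>

definition before_sum :: "'i \<Rightarrow> ('i \<Rightarrow> nat) \<Rightarrow> real" where
  "before_sum i m = (\<Sum>j | before j i. real (m j) * (\<alpha> i \<bullet> \<alpha> j))"

lemma before_sum_alt:
  "before_sum i m = (\<Sum>j\<in>UNIV. real (m j) * (if before j i then \<alpha> i \<bullet> \<alpha> j else 0))"
  unfolding before_sum_def by (intro sum.mono_neutral_cong_left) auto

text \<open>Changing \<beta> by \<alpha>_i in \<open>C_exp\<close> produces the pairings (\<nu>_j,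
  \<alpha>_i), whereas the F- and H-exponents know only \<nu>_i. \<open>\<nu>_inner_skew\<close>
  exchanges the indices at the cost of plus or minus (\<alpha>_i, \<alpha>_j), the sign depending on
  the side of i on which j stands.\<close>

lemma \<nu>_transpose:
  "(\<Sum>j\<in>UNIV. real (m j) * (\<nu> j \<bullet> \<alpha> i)) =
     qvec \<alpha> m \<bullet> \<nu> i - qvec \<alpha> m \<bullet> \<alpha> i + 2 * real (m i) * dd \<alpha> i + 2 * before_sum i m"
proof -
  have "\<nu> j \<bullet> \<alpha> i = \<alpha> j \<bullet> \<nu> i - \<alpha> j \<bullet> \<alpha> i + (if j = i then 2 * dd \<alpha> i else 0)
      + 2 * (if before j i then \<alpha> i \<bullet> \<alpha> j else 0)" for j
  proof (cases "j = i")
    case True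
    then show ?thesis by (simp add: before_irrefl dd_def inner_commute)
  next
    case False
    then consider "before j i" "\<not> before i j" | "before i j" "\<not> before j i"
      using before_total before_asym by blast
    then show ?thesis
      using \<nu>_inner_skew[of j i] \<nu>_inner_skew[of i j] False
      by cases (simp_all add: inner_commute[of "\<alpha> j"] inner_commute[of "\<alpha> i" "\<nu> j"])
  qed
  then have "(\<Sum>j\<in>UNIV. real (m j) * (\<nu> j \<bullet> \<alpha> i)) =
     (\<Sum>j\<in>UNIV. real (m j) * (\<alpha> j \<bullet> \<nu> i) - real (m j) * (\<alpha> j \<bullet> \<alpha> i)
        + (if j = i then real (m i) * (2 * dd \<alpha> i) else 0)
        + 2 * (real (m j) * (if before j i then \<alpha> i \<bullet> \<alpha> j else 0)))"
    by (intro sum.cong refl) (simp add: ring_distribs)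
  then show ?thesis
    by (simp add: sum.distrib sum_subtractf qvec_inner before_sum_alt sum_distrib_left)
qed

text \<open>The mixed second difference prescribed for \<open>C_exp\<close>, stored once for each
  pair in the order in which the factors stand.\<close>

definition \<nu>_form :: "'i \<Rightarrow> 'i \<Rightarrow> real" where
  "\<nu>_form i j = (if before i j then \<nu> i \<bullet> \<alpha> j - \<alpha> i \<bullet> \<alpha> j else 0)"

text \<open>This is the symmetry of mixed differences: for j before i the stored entry (\<nu>_j,
  \<alpha>_i) - (\<alpha>_j, \<alpha>_i) equals (\<nu>_i, \<alpha>_j) by
  \<open>\<nu>_inner_skew\<close>, so the derivative in direction i involves \<nu>_i alone.\<close>

lemma \<nu>_form_sum:
  "(\<Sum>j\<in>UNIV. real (m j) * (\<nu>_form i j + \<nu>_form j i)) =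
     qvec \<alpha> m \<bullet> \<nu> i - qvec \<alpha> m \<bullet> \<alpha> i + before_sum i m - real (m i) * (\<nu> i \<bullet> \<alpha> i - 2 * dd \<alpha> i)"
proof -
  have "\<nu>_form i j + \<nu>_form j i = \<alpha> j \<bullet> \<nu> i - \<alpha> j \<bullet> \<alpha> i + (if before j i then \<alpha> i \<bullet> \<alpha> j else 0)
      - (if j = i then \<nu> i \<bullet> \<alpha> i - 2 * dd \<alpha> i else 0)" for j
  proof (cases "j = i")
    case True
    then show ?thesis by (simp add: before_irrefl dd_def inner_commute \<nu>_form_def)
  next
    case False
    then consider "before j i" "\<not> before i j" | "before i j" "\<not> before j i"
      using before_total before_asym by blast
    then show ?thesis
      using \<nu>_inner_skew[of j i] \<nu>_inner_skew[of i j] False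
      by cases (simp_all add: \<nu>_form_def inner_commute[of "\<alpha> j"] inner_commute[of "\<alpha> i" "\<nu> j"])
  qed
  then have "(\<Sum>j\<in>UNIV. real (m j) * (\<nu>_form i j + \<nu>_form j i)) =
     (\<Sum>j\<in>UNIV. real (m j) * (\<alpha> j \<bullet> \<nu> i) - real (m j) * (\<alpha> j \<bullet> \<alpha> i)
        + real (m j) * (if before j i then \<alpha> i \<bullet> \<alpha> j else 0)
        - (if j = i then real (m i) * (\<nu> i \<bullet> \<alpha> i - 2 * dd \<alpha> i) else 0))"
    by (intro sum.cong refl) (simp add: ring_distribs)
  then show ?thesis
    by (simp add: sum.distrib sum_subtractf qvec_inner before_sum_alt)
qed

text \<open>
  Because \<open>q = v\<^sup>-\<^sup>1\<close>, the scalars belonging to the last three exponents are inverses of values of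
  \<open>ev\<close>.  The choice of \<open>C_exp\<close> is forced: its increment in \<open>m\<close> makes the \<open>K\<close>-part of the commutator
  \<open>[E\<^sub>i\<^sup>k, F\<^sub>i]\<close> cancel the term in which \<open>F\<^sub>i\<close> has been moved to the left, and its increment in
  \<open>\<beta>\<close> matches the remaining \<open>K\<^sup>-\<^sup>1\<close>-part with the Casimir eigenvalue.
\<close>

definition casimir_exp :: "('i \<Rightarrow> nat) \<Rightarrow> 'e \<times> real" where
  "casimir_exp \<beta> = 2 *\<^sub>R lam_pair (weyl_vector \<alpha>) (qvec \<alpha> \<beta>) - num (qvec \<alpha> \<beta> \<bullet> qvec \<alpha> \<beta>)"

definition H_exp :: "'i \<Rightarrow> ('i \<Rightarrow> nat) \<Rightarrow> ('i \<Rightarrow> nat) \<Rightarrow> 'e \<times> real" where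
  "H_exp i \<gamma> m = lam_pair (- qvec \<alpha> \<gamma>) (\<alpha> i) - num (real (m i) * dd \<alpha> i) - num (before_sum i m)"

definition F_exp :: "'i \<Rightarrow> ('i \<Rightarrow> nat) \<Rightarrow> 'e \<times> real" where
  "F_exp i \<delta> = lam_pair (- qvec \<alpha> (\<delta>(i := Suc (\<delta> i)))) (\<nu> i)"

definition C_exp :: "('i \<Rightarrow> nat) \<Rightarrow> ('i \<Rightarrow> nat) \<Rightarrow> 'e \<times> real" where
  "C_exp \<beta> m = (\<Sum>i\<in>UNIV. real (m i) *\<^sub>R lam_pair (- qvec \<alpha> \<beta>) (\<nu> i - \<alpha> i))
     + num (quadratic \<nu>_form (\<lambda>i. real (m i)))
     + num (\<Sum>i\<in>UNIV. real (m i) * (real (m i) - 1) / 2 * (\<nu> i \<bullet> \<alpha> i - dd \<alpha> i) - 2 * real (m i) * dd \<alpha> i)"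

lemma sum_upd_Suc:
  fixes f :: "'i \<Rightarrow> nat \<Rightarrow> 'a::ab_group_add"
  shows "(\<Sum>j\<in>UNIV. f j ((m(i := Suc (m i))) j)) = (\<Sum>j\<in>UNIV. f j (m j)) + f i (Suc (m i)) - f i (m i)"
  by (simp add: sum.remove[of UNIV i] add.commute)

text \<open>The cross terms are those of \<open>\<nu>_form_sum\<close>. The constant -2 d_i =
  -(\<alpha>_i, \<alpha>_i) built into \<open>C_exp\<close> arises because the H-exponent is taken
  one simple root below the degree at which \<open>C_exp\<close> is taken.\<close>

lemma C_exp_Suc:
  assumes "m \<le> \<delta>"
  shows "C_exp (\<delta>(i := Suc (\<delta> i))) (m(i := Suc (m i))) - C_exp (\<delta>(i := Suc (\<delta> i))) m
    = F_exp i (\<delta> - m) - H_exp i (\<delta> - m) m"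
proof -
  define \<beta> where "\<beta> = \<delta>(i := Suc (\<delta> i))"
  have upd: "(\<lambda>j. real ((m(i := Suc (m i))) j)) = (\<lambda>j. real (m j))(i := real (m i) + 1)"
    by auto
  define S where "S = (\<Sum>j\<in>UNIV. real (m j) * (\<nu>_form i j + \<nu>_form j i))"
  have quad: "quadratic \<nu>_form (\<lambda>j. real ((m(i := Suc (m i))) j)) = quadratic \<nu>_form (\<lambda>j. real (m j)) + S"
    unfolding upd quadratic_upd[of _ "\<lambda>j. real (m j)"] S_def by (simp add: \<nu>_form_def before_irrefl)
  have diff: "C_exp \<beta> (m(i := Suc (m i))) - C_exp \<beta> m = lam_pair (- qvec \<alpha> \<beta>) (\<nu> i - \<alpha> i)
      + num (S + real (m i) * (\<nu> i \<bullet> \<alpha> i - dd \<alpha> i) - 2 * dd \<alpha> i)"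
    unfolding C_exp_def quad
      sum_upd_Suc[of "\<lambda>i k. real k *\<^sub>R lam_pair (- qvec \<alpha> \<beta>) (\<nu> i - \<alpha> i)"]
      sum_upd_Suc[of "\<lambda>i k. real k * (real k - 1) / 2 * (\<nu> i \<bullet> \<alpha> i - dd \<alpha> i) - 2 * real k * dd \<alpha> i"]
    by (simp add: num_def prod_eq_iff scaleR_left_distrib field_simps)
  have q: "qvec \<alpha> \<beta> = qvec \<alpha> \<delta> + \<alpha> i"
    "qvec \<alpha> ((\<delta> - m)(i := Suc ((\<delta> - m) i))) = qvec \<alpha> \<delta> - qvec \<alpha> m + \<alpha> i"
    by (simp_all only: \<beta>_def qvec_Suc qvec_diff[OF assms])
  show ?thesis
    unfolding \<beta>_def[symmetric] diff F_exp_def H_exp_def q S_def \<nu>_form_sum qvec_diff[OF assms]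
    by (simp add: num_def lam_pair_def dd_def inner_add_left inner_diff_left inner_diff_right
        inner_commute[of "\<nu> i" "\<alpha> i"] algebra_simps)
qed

text \<open>The left side is the exponent of the K^-1-part that survives the cancellation in
  \<open>C_coefficients\<close>, the right side that of the Casimir eigenvalue times the old
  coefficient. Sevostyanov's condition enters through \<open>\<nu>_transpose\<close>.\<close>

lemma C_exp_shift:
  assumes "m \<le> \<delta>"
  shows "2 *\<^sub>R H_exp i (\<delta> - m) m - C_exp (\<delta>(i := Suc (\<delta> i))) m - F_exp i (\<delta> - m)
    = casimir_exp (\<delta>(i := Suc (\<delta> i))) - casimir_exp \<delta> - F_exp i \<delta> - C_exp \<delta> m"
proof -
  define \<beta> where "\<beta> = \<delta>(i := Suc (\<delta> i))"
  have q: "qvec \<alpha> \<beta> = qvec \<alpha> \<delta> + \<alpha> i"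
    "qvec \<alpha> ((\<delta> - m)(i := Suc ((\<delta> - m) i))) = qvec \<alpha> \<delta> - qvec \<alpha> m + \<alpha> i"
    by (simp_all only: \<beta>_def qvec_Suc qvec_diff[OF assms])
  define T where "T = (\<Sum>j\<in>UNIV. real (m j) * (\<nu> j \<bullet> \<alpha> i)) - qvec \<alpha> m \<bullet> \<alpha> i"
  have "C_exp \<beta> m = C_exp \<delta> m - (\<Sum>j\<in>UNIV. real (m j) *\<^sub>R num (\<alpha> i \<bullet> (\<nu> j - \<alpha> j)))"
    unfolding C_exp_def q
    by (simp add: prod_eq_iff fst_sum snd_sum lam_pair_def num_def inner_add_left inner_diff_left
        ring_distribs sum.distrib sum_subtractf sum_negf)
  also have "(\<Sum>j\<in>UNIV. real (m j) *\<^sub>R num (\<alpha> i \<bullet> (\<nu> j - \<alpha> j))) = num T"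
    by (simp add: prod_eq_iff fst_sum snd_sum num_def T_def qvec_inner inner_diff_right
        ring_distribs sum_subtractf inner_commute[of "\<alpha> i"])
  finally have C: "C_exp \<beta> m = C_exp \<delta> m - num T" .
  show ?thesis
    unfolding \<beta>_def[symmetric] C casimir_exp_def F_exp_def H_exp_def q T_def \<nu>_transpose qvec_diff[OF assms]
    using weyl_vector_inner[of i]
    by (simp add: prod_eq_iff num_def lam_pair_def dd_def algebra_simps
        inner_add_left inner_add_right inner_diff_left inner_diff_right
        inner_commute[of "\<nu> i" "\<alpha> i"] inner_commute[of "\<alpha> i" "qvec \<alpha> \<delta>"])
qed

section \<open>Integrality of the exponents\<close>

lemma half_Ints: "real k * (real k - 1) / 2 \<in> \<int>"
proof (induction k)
  case (Suc k)
  have "real (Suc k) * (real (Suc k) - 1) / 2 = real k * (real k - 1) / 2 + real k"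
    by (simp add: field_simps)
  then show ?case using Suc by (metis Ints_add Ints_of_nat)
qed simp

lemma num_lattice_intros:
  "num r \<in> lattice \<Longrightarrow> num s \<in> lattice \<Longrightarrow> num (r + s) \<in> lattice"
  "num r \<in> lattice \<Longrightarrow> num s \<in> lattice \<Longrightarrow> num (r - s) \<in> lattice"
  "r \<in> \<int> \<Longrightarrow> num s \<in> lattice \<Longrightarrow> num (r * s) \<in> lattice"
  using lattice_intros(2,3)[of "num r" "num s"] lattice_intros(5)[of r "num s"]
  by (simp_all add: num_def)

lemma num_sum_lattice: "(\<And>i. i \<in> A \<Longrightarrow> num (f i) \<in> lattice) \<Longrightarrow> num (sum f A) \<in> lattice"
  by (induction A rule: infinite_finite_induct)
    (auto intro: num_lattice_intros lattice_intros simp: num_def[of 0] zero_prod_def[symmetric])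

lemma casimir_exp_lattice: "casimir_exp \<beta> \<in> lattice"
  and F_exp_lattice: "F_exp i \<delta> \<in> lattice"
  unfolding casimir_exp_def F_exp_def
  by (intro lattice_intros num_in_lattice weyl_vector_in_weights qvec_in_weights weights_intros Ints_numeral)+

lemma before_sum_lattice: "num (before_sum i m) \<in> lattice"
  unfolding before_sum_def
  by (intro num_sum_lattice num_lattice_intros num_in_lattice weights_intros) simp

lemma H_exp_lattice: "H_exp i \<gamma> m \<in> lattice"
  unfolding H_exp_def
  by (intro lattice_intros(3,7) num_lattice_intros num_in_lattice before_sum_lattice
      qvec_in_weights weights_intros) simp

lemma quadratic_lattice:
  "(\<And>i j. num (B i j) \<in> lattice) \<Longrightarrow> num (quadratic B (\<lambda>i. real (m i))) \<in> lattice"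
  unfolding quadratic_def
  by (intro num_sum_lattice num_lattice_intros) auto

lemma num_if_lattice: "num r \<in> lattice \<Longrightarrow> num (if P then r else 0) \<in> lattice"
  by (simp add: num_def[of 0] zero_prod_def[symmetric] lattice_intros)

lemma C_exp_lattice: "C_exp \<beta> m \<in> lattice"
  unfolding C_exp_def \<nu>_form_def
  by (intro lattice_intros(2,5,7) lattice_sum quadratic_lattice num_if_lattice num_sum_lattice
      num_lattice_intros num_in_lattice qvec_in_weights weights_intros half_Ints Ints_mult) simp_all

lemma ev_sum: "(\<And>i. i \<in> A \<Longrightarrow> f i \<in> lattice) \<Longrightarrow> ev (sum f A) = (\<Prod>i\<in>A. ev (f i))"
  by (induction A rule: infinite_finite_induct) (auto simp: ev_0 ev_add lattice_sum)

lemma ev_num_mult: "num r \<in> lattice \<Longrightarrow> ev (num (real k * r)) = ev (num r) ^ k"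
  using ev_of_nat[of "num r" k] by (simp add: num_def)

lemma ev_num_sum: "(\<And>i. i \<in> A \<Longrightarrow> num (f i) \<in> lattice) \<Longrightarrow> ev (num (sum f A)) = (\<Prod>i\<in>A. ev (num (f i)))"
proof -
  have "num (sum f A) = (\<Sum>i\<in>A. num (f i) :: 'e \<times> real)"
    by (simp add: num_def prod_eq_iff fst_sum snd_sum)
  then show "(\<And>i. i \<in> A \<Longrightarrow> num (f i) \<in> lattice) \<Longrightarrow> ?thesis"
    by (simp add: ev_sum)
qed

section \<open>The coefficients as field elements\<close>

abbreviation vq :: "'i \<Rightarrow> 'i kfield" where "vq i \<equiv> vi \<alpha> N vroot i"

lemma v_nonzero: "vq i \<noteq> 0"
  by (simp add: vi_eq ev_nonzero)

lemma v_power_eq_1: "vq i ^ k = 1 \<longleftrightarrow> k = 0"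
proof
  assume "vq i ^ k = 1"
  then have "ev (num (real k * dd \<alpha> i)) = 1"
    by (simp add: vi_eq ev_num_mult num_in_lattice)
  moreover have "real N * (real k * dd \<alpha> i) \<in> \<int>"
    using N_dd[of i] by (simp add: mult.left_commute[of "real N"])
  ultimately have "real k * dd \<alpha> i = 0" by (rule ev_num_eq_1[rotated])
  then show "k = 0" using dd_pos[of i] by simp
qed simp

lemma v_power_neq_inverse:
  assumes "k > 0"
  shows "vq i ^ k \<noteq> inverse (vq i ^ k)"
proof
  assume "vq i ^ k = inverse (vq i ^ k)"
  then have "vq i ^ (k + k) = 1"
    unfolding power_add by (metis right_inverse v_nonzero power_not_zero)
  then show False using assms by (simp only: v_power_eq_1)
qed

lemma v_neq_inverse: "vq i - inverse (vq i) \<noteq> 0"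
  using v_power_neq_inverse[of 1 i] by simp

text \<open>Balanced q-integers are unchanged under inversion of q, so the algebra at v^-1 can be
  handled with v itself.\<close>

lemma qint_v:
  "qint (inverse (vq i)) k = (vq i ^ k - inverse (vq i ^ k)) / (vq i - inverse (vq i))"
proof -
  have "qint (inverse (vq i)) k = - (vq i ^ k - inverse (vq i ^ k)) / - (vq i - inverse (vq i))"
    by (simp add: qint_def power_inverse)
  then show ?thesis by (simp only: minus_divide_divide)
qed

lemma qint_v_nonzero: "k > 0 \<Longrightarrow> qint (inverse (vq i)) k \<noteq> 0"
  unfolding qint_v using v_power_neq_inverse[of k i] v_neq_inverse[of i] by simp

text \<open>Coefficients of a product of q-exponentials: the q-factorials turn the powers in
  \<open>E_prod\<close> into divided powers, and the base is the one for which
  \<open>prefactor_Suc\<close> compensates both the q-integer and the denominator in the commutator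
  formula.\<close>

definition prefactor :: "('i \<Rightarrow> nat) \<Rightarrow> 'i kfield" where
  "prefactor m = (\<Prod>i\<in>UNIV. ((vq i - inverse (vq i)) * c i) ^ m i / qfact (inverse (vq i)) (m i))"

lemma prefactor_Suc:
  "prefactor (m(i := Suc (m i))) * qint (inverse (vq i)) (Suc (m i)) = prefactor m * ((vq i - inverse (vq i)) * c i)"
proof -
  define x where "x = (vq i - inverse (vq i)) * c i"
  define Q where "Q = qint (inverse (vq i)) (Suc (m i))"
  have "qfact (inverse (vq i)) (Suc (m i)) = qfact (inverse (vq i)) (m i) * Q"
    by (simp add: qfact_def Q_def)
  moreover have "Q \<noteq> 0" by (simp add: Q_def qint_v_nonzero)
  ultimately show ?thesis
    by (simp add: prefactor_def prod.remove[of UNIV i] x_def[symmetric] Q_def[symmetric])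
qed

definition C :: "('i \<Rightarrow> nat) \<Rightarrow> ('i \<Rightarrow> nat) \<Rightarrow> 'i kfield" where
  "C \<beta> m = prefactor m / ev (C_exp \<beta> m)"

lemma C_0: "C \<beta> (\<lambda>i. 0) = 1"
proof -
  have "C_exp \<beta> (\<lambda>i. 0) = 0" by (simp add: C_exp_def quadratic_def num_def prod_eq_iff)
  then show ?thesis by (simp add: C_def prefactor_def qfact_def ev_0)
qed

lemma C_coefficients:
  fixes m \<delta> :: "'i \<Rightarrow> nat" and i :: 'i
  defines "q \<equiv> inverse (vq i)" and "\<beta> \<equiv> \<delta>(i := Suc (\<delta> i))" and "h \<equiv> inverse (ev (H_exp i (\<delta> - m) m))"
  assumes "m \<le> \<delta>"
  shows "C \<beta> m * (c i / ev (F_exp i (\<delta> - m)))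
      + C \<beta> (m(i := Suc (m i))) * (qint q (Suc (m i)) / (q - inverse q)) * (h - inverse h)
      = ev (casimir_exp \<beta>) / ev (casimir_exp \<delta>) * (c i / ev (F_exp i \<delta>)) * C \<delta> m"
proof -
  note [simp] = C_exp_lattice F_exp_lattice H_exp_lattice casimir_exp_lattice ev_nonzero
  let ?h = "ev (H_exp i (\<delta> - m) m)" and ?f = "ev (F_exp i (\<delta> - m))" and ?C = "ev (C_exp \<beta> m)"
  have "C_exp \<beta> (m(i := Suc (m i))) = C_exp \<beta> m + F_exp i (\<delta> - m) - H_exp i (\<delta> - m) m"
    using C_exp_Suc[OF assms(4), of i] by (simp add: \<beta>_def algebra_simps)
  then have up: "ev (C_exp \<beta> (m(i := Suc (m i)))) = ?C * ?f / ?h"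
    by (simp add: ev_add ev_diff lattice_intros)
  define d where "d = vq i - inverse (vq i)"
  have d: "q - inverse q = - d" and d0: "d \<noteq> 0"
    using v_neq_inverse[of i] by (simp_all add: q_def d_def)
  have "C \<beta> (m(i := Suc (m i))) * (qint q (Suc (m i)) / (q - inverse q))
      = prefactor m * (d * c i) / (?C * ?f / ?h) / (q - inverse q)"
    unfolding C_def up q_def d_def prefactor_Suc[symmetric] by simp
  also have "\<dots> = - (prefactor m * c i * ?h / (?C * ?f))"
    unfolding d using d0 by (simp add: field_simps)
  finally have up_coeff: "C \<beta> (m(i := Suc (m i))) * (qint q (Suc (m i)) / (q - inverse q))
      = - (prefactor m * c i * ?h / (?C * ?f))" .
  \<comment> \<open>In the factor \<open>h - inverse h\<close>, the K-part \<open>h\<close> cancels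
    the first summand exactly; the K^-1-part leaves the square of \<open>?h\<close>.\<close>
  have "C \<beta> m * (c i / ?f) + C \<beta> (m(i := Suc (m i))) * (qint q (Suc (m i)) / (q - inverse q)) * (h - inverse h)
      = prefactor m * c i * (?h * ?h / (?C * ?f))"
    unfolding up_coeff h_def C_def[of \<beta> m] by (simp add: field_simps)
  also have "?h * ?h / (?C * ?f) = ev (2 *\<^sub>R H_exp i (\<delta> - m) m - C_exp \<beta> m - F_exp i (\<delta> - m))"
    using ev_of_nat[of "H_exp i (\<delta> - m) m" 2]
    by (simp add: ev_diff lattice_intros power2_eq_square)
  also have "\<dots> = ev (casimir_exp \<beta>) / ev (casimir_exp \<delta>) / ev (F_exp i \<delta>) / ev (C_exp \<delta> m)"
    using C_exp_shift[OF assms(4), of i] by (simp add: \<beta>_def ev_diff lattice_intros)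
  finally show ?thesis unfolding C_def[of \<delta>] by (simp only: times_divide_eq_left times_divide_eq_right divide_divide_eq_left mult_ac)
qed

lemma H_eq:
  "inverse (ev (lam_pair (- qvec \<alpha> \<gamma>) (\<alpha> i)))
      / (inverse (vq i) ^ m i * (\<Prod>j | before j i. inverse (ev (num (\<alpha> i \<bullet> \<alpha> j))) ^ m j))
    = inverse (ev (H_exp i \<gamma> m))"
proof -
  have "ev (num (before_sum i m)) = (\<Prod>j | before j i. ev (num (\<alpha> i \<bullet> \<alpha> j)) ^ m j)"
    by (simp add: before_sum_def ev_num_sum num_lattice_intros num_in_lattice weights_intros ev_num_mult)
  moreover have "ev (num (real (m i) * dd \<alpha> i)) = vq i ^ m i"
    by (simp add: vi_eq ev_num_mult num_in_lattice)
  ultimately have "ev (H_exp i \<gamma> m) = ev (lam_pair (- qvec \<alpha> \<gamma>) (\<alpha> i)) / vq i ^ m i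
      / (\<Prod>j | before j i. ev (num (\<alpha> i \<bullet> \<alpha> j)) ^ m j)"
    by (simp add: H_exp_def ev_diff lattice_intros(3) lattice_intros(7) num_lattice_intros num_in_lattice
        before_sum_lattice qvec_in_weights weights_intros)
  then show ?thesis
    by (simp add: power_inverse prod_inversef[unfolded o_def] divide_inverse mult_ac)
qed

section \<open>Exponents of the second Whittaker vector\<close>

definition \<nu>'_form :: "'i \<Rightarrow> 'i \<Rightarrow> real" where
  "\<nu>'_form i j = (if before i j then \<nu>' i \<bullet> \<alpha> j else 0)"

text \<open>The power of v produced by the ordered product on \<open>\<theta>'\<close> in degree
  \<beta>. Factors further right act first and lower the degree seen by those further left, whence
  the cross terms for \<open>before i j\<close> and the triangular numbers on the diagonal.\<close>

definition E_exp :: "('i \<Rightarrow> nat) \<Rightarrow> ('i \<Rightarrow> nat) \<Rightarrow> 'e \<times> real" where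
  "E_exp \<beta> m = (\<Sum>i\<in>UNIV. real (m i) *\<^sub>R lam_pair (- qvec \<alpha> \<beta>) (\<nu>' i))
     + num (quadratic \<nu>'_form (\<lambda>i. real (m i)))
     + num (\<Sum>i\<in>UNIV. real (m i) * (real (m i) - 1) / 2 * (\<nu>' i \<bullet> \<alpha> i))"

lemma E_exp_lattice: "E_exp \<beta> m \<in> lattice"
  unfolding E_exp_def \<nu>'_form_def
  by (intro lattice_intros(2,5,7) lattice_sum quadratic_lattice num_if_lattice num_sum_lattice
      num_lattice_intros num_in_lattice qvec_in_weights weights_intros half_Ints Ints_mult) simp_all

text \<open>The new factor stands to the left of all those already present, so it acts in degree
  \<beta> - m.\<close>

lemma E_exp_upd:
  assumes m: "m i = 0" "m \<le> \<beta>" and before: "\<And>j. m j \<noteq> 0 \<Longrightarrow> before i j"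
  shows "E_exp \<beta> (m(i := k)) = E_exp \<beta> m +
    (real k *\<^sub>R lam_pair (- qvec \<alpha> (\<beta> - m)) (\<nu>' i) + num (real k * (real k - 1) / 2 * (\<nu>' i \<bullet> \<alpha> i)))"
proof -
  have upd: "(\<lambda>j. real ((m(i := k)) j)) = (\<lambda>j. real (m j))(i := real (m i) + real k)"
    using m by auto
  have "real (m j) * (\<nu>'_form i j + \<nu>'_form j i) = real (m j) * (\<alpha> j \<bullet> \<nu>' i)" for j
    using before[of j] before_asym[of i j] by (cases "m j = 0") (auto simp: \<nu>'_form_def inner_commute)
  then have "(\<Sum>j\<in>UNIV. real (m j) * (\<nu>'_form i j + \<nu>'_form j i)) = qvec \<alpha> m \<bullet> \<nu>' i"
    unfolding qvec_inner by (rule sum.cong[OF refl])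
  then have quad: "quadratic \<nu>'_form (\<lambda>j. real ((m(i := k)) j))
      = quadratic \<nu>'_form (\<lambda>j. real (m j)) + real k * (qvec \<alpha> m \<bullet> \<nu>' i)"
    unfolding upd quadratic_upd[of _ "\<lambda>j. real (m j)"] by (simp add: \<nu>'_form_def before_irrefl)
  have sums: "(\<Sum>j\<in>UNIV. f j ((m(i := k)) j)) = (\<Sum>j\<in>UNIV. f j (m j)) + f i k - f i 0"
    for f :: "'i \<Rightarrow> nat \<Rightarrow> 'z::ab_group_add"
    using m(1) by (simp add: sum.remove[of UNIV i] add.commute)
  show ?thesis
    unfolding E_exp_def quad
      sums[of "\<lambda>i k. real k *\<^sub>R lam_pair (- qvec \<alpha> \<beta>) (\<nu>' i)"]
      sums[of "\<lambda>i k. real k * (real k - 1) / 2 * (\<nu>' i \<bullet> \<alpha> i)"] qvec_diff[OF m(2)]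
    by (simp add: num_def lam_pair_def prod_eq_iff inner_diff_left algebra_simps)
qed

text \<open>The terms in \<lambda> and the pairing of \<beta> with m cancel between the eigenvalue,
  the two normalizations and the \<alpha>-part of \<open>C_exp\<close>. The remaining -(m, m)/2 and
  2(\<rho>, m) are consumed by the (\<alpha>_i, \<alpha>_j)-part of \<open>\<nu>_form\<close> and
  the diagonal sums. Only the differences \<nu>'_i - \<nu>_i are left, and they form
  \<open>tau\<close>.\<close>

lemma exponent_identity:
  assumes "m \<le> \<beta>"
  defines "nrm \<equiv> \<lambda>\<beta>. num (- (qvec \<alpha> \<beta> \<bullet> qvec \<alpha> \<beta>) / 2) + lam_pair 0 (qvec \<alpha> \<beta>)"
    and "\<gamma> \<equiv> \<beta> - m"
  shows "num (\<Sum>i\<in>UNIV. real (m i) * (real (m i) + 1) / 2 * dd \<alpha> i) + E_exp \<beta> m - C_exp \<beta> m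
      + nrm \<beta> - casimir_exp \<beta> - nrm \<gamma>
    = num (qvec \<alpha> \<gamma> \<bullet> qvec \<alpha> \<gamma>) - 2 *\<^sub>R lam_pair (weyl_vector \<alpha>) (qvec \<alpha> \<gamma>)
      + tau \<alpha> prec n n' m \<beta>" (is "?l = ?r")
proof -
  let ?m = "\<lambda>i. real (m i)"
  have \<gamma>: "qvec \<alpha> \<gamma> = qvec \<alpha> \<beta> - qvec \<alpha> m" using assms(1) by (simp add: \<gamma>_def qvec_diff)
  define Sd where "Sd = (\<Sum>i\<in>UNIV. ?m i * dd \<alpha> i)"
  define Sdd where "Sdd = (\<Sum>i\<in>UNIV. ?m i * ?m i * dd \<alpha> i)"
  define A where "A = (\<Sum>i\<in>UNIV. ?m i * (?m i - 1) / 2 * (\<nu> i \<bullet> \<alpha> i))"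
  define A' where "A' = (\<Sum>i\<in>UNIV. ?m i * (?m i - 1) / 2 * (\<nu>' i \<bullet> \<alpha> i))"
  define B where "B = (\<Sum>i\<in>UNIV. ?m i * (qvec \<alpha> \<beta> \<bullet> \<nu> i))"
  define B' where "B' = (\<Sum>i\<in>UNIV. ?m i * (qvec \<alpha> \<beta> \<bullet> \<nu>' i))"
  define R where "R = quadratic (\<lambda>i j. if before i j then \<alpha> i \<bullet> \<alpha> j else 0) ?m"
  have \<rho>: "weyl_vector \<alpha> \<bullet> qvec \<alpha> m = Sd"
    by (simp add: Sd_def qvec_def inner_sum_right weyl_vector_inner)
  \<comment> \<open>The square splits into the pairs in either order, each contributing R, and the
    diagonal with entries 2 d_i.\<close>
  have norm: "qvec \<alpha> m \<bullet> qvec \<alpha> m = 2 * R + 2 * Sdd"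
  proof -
    have "qvec \<alpha> m \<bullet> qvec \<alpha> m = quadratic (\<lambda>i j. \<alpha> i \<bullet> \<alpha> j) ?m"
    proof -
      have "\<alpha> i \<bullet> qvec \<alpha> m = (\<Sum>j\<in>UNIV. ?m j * (\<alpha> i \<bullet> \<alpha> j))" for i
        by (simp only: qvec_def inner_sum_right inner_scaleR_right)
      then show ?thesis
        unfolding quadratic_def qvec_inner[of \<alpha> m "qvec \<alpha> m"] by (simp only: sum_distrib_left mult.assoc)
    qed
    also have "\<dots> = (\<Sum>i\<in>UNIV. \<Sum>j\<in>UNIV. ?m i * ?m j * (if before i j then \<alpha> i \<bullet> \<alpha> j else 0)
        + ?m i * ?m j * (if before j i then \<alpha> j \<bullet> \<alpha> i else 0) + (if j = i then 2 * (?m i * ?m i * dd \<alpha> i) else 0))"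
      unfolding quadratic_def
      by (intro sum.cong refl) (use before_irrefl before_asym before_total in
        \<open>auto simp: dd_def inner_commute\<close>, metis)
    also have "\<dots> = R + (\<Sum>i\<in>UNIV. \<Sum>j\<in>UNIV. ?m i * ?m j * (if before j i then \<alpha> j \<bullet> \<alpha> i else 0)) + 2 * Sdd"
      by (simp only: sum.distrib R_def quadratic_def Sdd_def sum_distrib_left) simp
    also have "(\<Sum>i\<in>UNIV. \<Sum>j\<in>UNIV. ?m i * ?m j * (if before j i then \<alpha> j \<bullet> \<alpha> i else 0)) = R"
      unfolding R_def quadratic_def by (subst sum.swap) (simp add: mult_ac)
    finally show ?thesis by simp
  qed
  have quad: "quadratic \<nu>_form ?m = quadratic (\<lambda>i j. if before i j then \<nu> i \<bullet> \<alpha> j else 0) ?m - R"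
    unfolding R_def quadratic_def \<nu>_form_def sum_subtractf[symmetric]
    by (intro sum.cong refl) (simp add: algebra_simps)
  have tau_quad: "(\<Sum>(i, j) | prec (\<alpha> j) (\<alpha> i). ?m i * ?m j * ((\<nu>' i - \<nu> i) \<bullet> \<alpha> j))
      = quadratic \<nu>'_form ?m - quadratic (\<lambda>i j. if before i j then \<nu> i \<bullet> \<alpha> j else 0) ?m"
  proof -
    have "(\<Sum>(i, j) | prec (\<alpha> j) (\<alpha> i). ?m i * ?m j * ((\<nu>' i - \<nu> i) \<bullet> \<alpha> j))
      = (\<Sum>(i, j)\<in>UNIV \<times> UNIV. if before i j then ?m i * ?m j * ((\<nu>' i - \<nu> i) \<bullet> \<alpha> j) else 0)"
      unfolding before_def by (intro sum.mono_neutral_cong_left) (auto split: if_splits)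
    also have "\<dots> = (\<Sum>i\<in>UNIV. \<Sum>j\<in>UNIV. if before i j then ?m i * ?m j * ((\<nu>' i - \<nu> i) \<bullet> \<alpha> j) else 0)"
      by (rule sum.cartesian_product[symmetric])
    also have "\<dots> = quadratic \<nu>'_form ?m - quadratic (\<lambda>i j. if before i j then \<nu> i \<bullet> \<alpha> j else 0) ?m"
      unfolding quadratic_def \<nu>'_form_def sum_subtractf[symmetric]
      by (intro sum.cong refl) (simp add: inner_diff_left algebra_simps)
    finally show ?thesis .
  qed
  have sums: "(\<Sum>i\<in>UNIV. ?m i * (?m i + 1) / 2 * dd \<alpha> i) = (Sdd + Sd) / 2"
    "(\<Sum>i\<in>UNIV. ?m i * (?m i - 1) / 2 * (\<nu> i \<bullet> \<alpha> i - dd \<alpha> i) - 2 * ?m i * dd \<alpha> i) = A - (Sdd - Sd) / 2 - 2 * Sd"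
    "(\<Sum>i\<in>UNIV. ?m i * (?m i - 1) / 2 * ((\<nu>' i - \<nu> i) \<bullet> \<alpha> i)) = A' - A"
    unfolding Sdd_def Sd_def A_def A'_def sum_divide_distrib sum_distrib_left
      sum.distrib[symmetric] sum_subtractf[symmetric]
    by (intro sum.cong refl; simp add: inner_diff_left algebra_simps add_divide_distrib diff_divide_distrib)+
  have lin: "(\<Sum>i\<in>UNIV. ?m i *\<^sub>R lam_pair (- qvec \<alpha> \<beta>) (\<nu> i - \<alpha> i))
      = ((\<Sum>i\<in>UNIV. ?m i *\<^sub>R \<nu> i) - qvec \<alpha> m, qvec \<alpha> \<beta> \<bullet> qvec \<alpha> m - B)"
    "(\<Sum>i\<in>UNIV. ?m i *\<^sub>R lam_pair (- qvec \<alpha> \<beta>) (\<nu>' i)) = ((\<Sum>i\<in>UNIV. ?m i *\<^sub>R \<nu>' i), - B')"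
    "(\<Sum>i\<in>UNIV. ?m i *\<^sub>R lam_pair (- qvec \<alpha> \<beta>) (\<nu>' i - \<nu> i))
      = ((\<Sum>i\<in>UNIV. ?m i *\<^sub>R \<nu>' i) - (\<Sum>i\<in>UNIV. ?m i *\<^sub>R \<nu> i), B - B')"
    by (simp_all add: prod_eq_iff fst_sum snd_sum lam_pair_def B_def B'_def qvec_def[of \<alpha> m] inner_sum_right
        inner_diff_right scaleR_right_diff_distrib right_diff_distrib sum_subtractf sum_negf)
  show ?thesis
  proof (rule prod_eqI)
    show "fst ?l = fst ?r"
      unfolding E_exp_def C_exp_def tau_def lin nrm_def casimir_exp_def \<gamma>
      by (simp add: num_def lam_pair_def algebra_simps scaleR_2)
    show "snd ?l = snd ?r"
      unfolding E_exp_def C_exp_def tau_def lin nrm_def casimir_exp_def \<gamma> sums quad tau_quad A'_def[symmetric]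
      using norm \<rho>
      by (simp add: num_def lam_pair_def inner_diff_left inner_diff_right
          inner_commute[of "qvec \<alpha> m" "qvec \<alpha> \<beta>"] field_simps)
  qed
qed

end

section \<open>Modules over the quantum group\<close>

lemma sigma_gen: "sigma (gen g :: ('i, 'k::field) qfree) = gen (sigma_gen g)"
  by (simp add: sigma_def gen_def)

lemma poly_mapping_add_induct [case_names zero single add]:
  fixes P :: "('a \<Rightarrow>\<^sub>0 'b::comm_monoid_add) \<Rightarrow> bool"
  assumes "P 0" "\<And>k c. P (Poly_Mapping.single k c)" "\<And>x y. P x \<Longrightarrow> P y \<Longrightarrow> P (x + y)"
  shows "P x"
proof (induction x rule: update_induct)
  case const
  then show ?case by (rule assms)
next
  case (update f a b)
  have "Poly_Mapping.update a b f = f + Poly_Mapping.single a b"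
    using update.hyps by (intro poly_mapping_eqI) (auto simp: lookup_update lookup_add lookup_single in_keys_iff)
  then show ?case using update assms by simp
qed

locale quantum_module =
  fixes \<alpha> :: "'i::finite \<Rightarrow> 'e::euclidean_space" and N :: nat and w :: "'k::field"
    and scl :: "'k \<Rightarrow> 'v::ab_group_add \<Rightarrow> 'v" and act :: "('i, 'k) qfree \<Rightarrow> 'v \<Rightarrow> 'v"
  assumes module: "uq_module \<alpha> N w scl act"
begin

sublocale vector_space scl
  using module by (simp add: uq_module_def)

lemma act_linear: "Vector_Spaces.linear scl scl (act x)"
  using module by (simp add: uq_module_def)

lemmas act_right =
  module_hom.add[OF act_linear[THEN Vector_Spaces.linear.axioms(3)]]
  module_hom.scale[OF act_linear[THEN Vector_Spaces.linear.axioms(3)]]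
  module_hom.diff[OF act_linear[THEN Vector_Spaces.linear.axioms(3)]]
  module_hom.zero[OF act_linear[THEN Vector_Spaces.linear.axioms(3)]]

lemma act_left:
  "act (x + y) m = act x m + act y m"
  "act (x * y) m = act x (act y m)"
  "act (const c) m = scl c m"
  using module by (simp_all add: uq_module_def)

lemma act_diff: "act (x - y) m = act x m - act y m"
  using act_left(1)[of "x - y" y m] by simp

lemma act_zero: "act 0 m = 0"
  using act_left(1)[of 0 0 m] by simp

lemma act_one: "act 1 m = m"
  using act_left(3)[of 1 m] by (simp add: const_def)

lemma act_relation: "x \<in> qrelations \<alpha> N w \<Longrightarrow> act x m = 0"
  using module unfolding uq_module_def uq_ideal_def by (meson hull_inc)

lemma K_K: "act (qK \<mu>) (act (qK \<mu>') m) = act (qK (\<lambda>i. \<mu> i + \<mu>' i)) m"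
proof -
  have "qK \<mu> * qK \<mu>' - qK (\<lambda>i. \<mu> i + \<mu>' i) \<in> qrelations \<alpha> N w"
    unfolding qrelations_def by (rule UnI1, rule UnI1, rule UnI1, rule UnI1, rule UnI1, rule UnI1, rule CollectI, intro exI conjI, rule refl, rule TrueI)
  from act_relation[OF this, of m] show ?thesis by (simp add: act_diff act_left)
qed

lemma K_0: "act (qK (\<lambda>i. 0)) m = m"
proof -
  have "qK (\<lambda>i. 0) - 1 \<in> qrelations \<alpha> N w"
    unfolding qrelations_def by (rule UnI1, rule UnI1, rule UnI1, rule UnI1, rule UnI1, rule UnI2, rule singletonI)
  from act_relation[OF this, of m] show ?thesis by (simp add: act_diff act_one)
qed

lemma K_E: "act (qK \<mu>) (act (qE i) m) = scl (vpow N w (pvec \<alpha> \<mu> \<bullet> \<alpha> i)) (act (qE i) (act (qK \<mu>) m))"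
proof -
  have "qK \<mu> * qE i * qK (\<lambda>j. - \<mu> j) - const (vpow N w (pvec \<alpha> \<mu> \<bullet> \<alpha> i)) * qE i \<in> qrelations \<alpha> N w"
    unfolding qrelations_def by (rule UnI1, rule UnI1, rule UnI1, rule UnI1, rule UnI2, rule CollectI, intro exI conjI, rule refl, rule TrueI)
  from act_relation[OF this, of "act (qK \<mu>) m"] show ?thesis
    by (simp add: act_diff act_left K_K K_0)
qed

lemma K_F: "act (qK \<mu>) (act (qF i) m) = scl (vpow N w (- (pvec \<alpha> \<mu> \<bullet> \<alpha> i))) (act (qF i) (act (qK \<mu>) m))"
proof -
  have "qK \<mu> * qF i * qK (\<lambda>j. - \<mu> j) - const (vpow N w (- (pvec \<alpha> \<mu> \<bullet> \<alpha> i))) * qF i \<in> qrelations \<alpha> N w"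
    unfolding qrelations_def by (rule UnI1, rule UnI1, rule UnI1, rule UnI2, rule CollectI, intro exI conjI, rule refl, rule TrueI)
  from act_relation[OF this, of "act (qK \<mu>) m"] show ?thesis
    by (simp add: act_diff act_left K_K K_0)
qed

lemma E_F:
  "act (qE i) (act (qF j) m) = act (qF j) (act (qE i) m) +
     (if i = j then scl (inverse (vi \<alpha> N w i - inverse (vi \<alpha> N w i)))
        (act (qKalpha \<alpha> i) m - act (qKalpha_inv \<alpha> i) m) else 0)"
proof -
  have "qE i * qF j - qF j * qE i
        - (if i = j
           then const (inverse (vi \<alpha> N w i - inverse (vi \<alpha> N w i))) * (qKalpha \<alpha> i - qKalpha_inv \<alpha> i)
           else 0) \<in> qrelations \<alpha> N w"
    unfolding qrelations_def by (rule UnI1, rule UnI1, rule UnI2, rule CollectI, intro exI conjI, rule refl, rule TrueI)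
  from act_relation[OF this, of m] show ?thesis
    by (cases "i = j") (simp_all add: act_diff act_left diff_eq_eq act_zero)
qed

text \<open>The spanning half of the triangular decomposition: K and E can be moved to the right
  past every \<open>F j\<close>, up to scalars and Cartan terms, and on \<open>one\<close> they act
  by scalars or zero. So the span is a submodule containing the generator, and linear identities can
  be proved by induction along \<open>F_span\<close>.\<close>

lemma F_span_UNIV:
  assumes generated: "\<And>m. \<exists>x. m = act x one"
    and E_one: "\<And>i. act (qE i) one = 0"
    and K_one: "\<And>\<mu>. \<exists>c. act (qK \<mu>) one = scl c one"
  shows "F_span scl (\<lambda>i. act (qF i)) one = UNIV"
proof -
  let ?S = "F_span scl (\<lambda>i. act (qF i)) one"
  note intros = F_span.intros[where scl = scl and F = "\<lambda>i. act (qF i)" and one = one]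
  have zero: "0 \<in> ?S"
    using intros(3)[OF intros(1), of 0] by simp
  have diff: "x \<in> ?S \<Longrightarrow> y \<in> ?S \<Longrightarrow> x - y \<in> ?S" for x y
    using intros(2)[of x, OF _ intros(3)[of y "-1"]] by simp
  have K: "act (qK \<mu>) m \<in> ?S" if "m \<in> ?S" for m \<mu>
    using that
  proof (induction rule: F_span.induct)
    case one
    then show ?case using K_one[of \<mu>] intros(1,3) by auto
  qed (auto simp: act_right K_F intro: intros(2-4))
  have E: "act (qE i) m \<in> ?S" if "m \<in> ?S" for m i
    using that
  proof (induction rule: F_span.induct)
    case (F m j)
    then show ?case
      unfolding E_F qKalpha_def qKalpha_inv_def
      by (auto intro!: intros(2-4) zero diff K)
  qed (auto simp: act_right E_one zero intro: intros(2-4))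
  have gen: "act (gen g) m \<in> ?S" if "m \<in> ?S" for g m
    using that by (cases g) (auto intro: E K intros(4))
  have word: "act (Poly_Mapping.single (Word gs) c) m \<in> ?S" if "m \<in> ?S" for gs c m
  proof (induction gs)
    case Nil
    have "act (Poly_Mapping.single (Word []) c) m = scl c m"
      using act_left(3)[of c m] by (simp add: const_def zero_word_def)
    then show ?case using that by (simp add: intros(3))
  next
    case (Cons g gs)
    have "act (Poly_Mapping.single (Word (g # gs)) c) m = act (gen g) (act (Poly_Mapping.single (Word gs) c) m)"
      by (simp add: gen_def mult_single act_left(2)[symmetric])
    then show ?case using Cons by (simp add: gen)
  qed
  have "act x one \<in> ?S" for x
  proof (induction x rule: poly_mapping_add_induct)
    case (single k c)
    then show ?case using word[OF intros(1)] by (cases k) simp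
  qed (auto simp: act_zero act_left zero intro: intros(2))
  then show ?thesis using generated by (metis UNIV_eq_I)
qed

end

section \<open>Pairing two Whittaker vectors\<close>

locale whittaker_pair = casimir_exponents \<Delta> \<alpha> N \<epsilon> n n' c c' prec
  for \<Delta> :: "'e::euclidean_space set" and \<alpha> :: "'i::{finite,linorder} \<Rightarrow> 'e" and N
    and \<epsilon> n n' :: "'i \<Rightarrow> 'i \<Rightarrow> int" and c c' :: "'i \<Rightarrow> 'i kfield" and prec :: "'e \<Rightarrow> 'e \<Rightarrow> bool" +
  fixes scl :: "'i kfield \<Rightarrow> 'v::ab_group_add \<Rightarrow> 'v"
    and act :: "('i, 'i kfield) qfree \<Rightarrow> 'v \<Rightarrow> 'v"
    and one :: 'v
    and scl' :: "'i kfield \<Rightarrow> 'w::ab_group_add \<Rightarrow> 'w"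
    and act' :: "('i, 'i kfield) qfree \<Rightarrow> 'w \<Rightarrow> 'w"
    and one' :: 'w
    and pr :: "'v \<Rightarrow> 'w \<Rightarrow> 'i kfield"
    and \<theta> :: "('i \<Rightarrow> nat) \<Rightarrow> 'v"
    and \<theta>' :: "('i \<Rightarrow> nat) \<Rightarrow> 'w"
  assumes verma: "verma_module \<alpha> N vroot uvar scl act one"
    and verma': "verma_module \<alpha> N (inverse vroot) (\<lambda>i. inverse (uvar i)) scl' act' one'"
    and pairing: "shapovalov_pairing scl act one scl' act' one' pr"
    and whittaker: "whittaker_vector \<alpha> N vroot uvar scl act one n c \<theta>"
    and whittaker': "whittaker_vector \<alpha> N (inverse vroot) (\<lambda>i. inverse (uvar i)) scl' act' one' n' c' \<theta>'"
begin

sublocale V: quantum_module \<alpha> N vroot scl act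
  using verma by unfold_locales (simp add: verma_module_def)

sublocale W: quantum_module \<alpha> N "inverse vroot" scl' act'
  using verma' by unfold_locales (simp add: verma_module_def)

definition \<psi> :: "('i \<Rightarrow> nat) \<Rightarrow> 'w \<Rightarrow> 'i kfield" where
  "\<psi> \<beta> y = pr (\<theta> \<beta>) y"

lemma linear_\<psi>: "Vector_Spaces.linear scl' (*) (\<psi> \<beta>)"
  using pairing by (simp add: shapovalov_pairing_def \<psi>_def[abs_def])

lemmas \<psi>_right =
  module_hom.add[OF linear_\<psi>[THEN Vector_Spaces.linear.axioms(3)]]
  module_hom.scale[OF linear_\<psi>[THEN Vector_Spaces.linear.axioms(3)]]

lemma pr_scale_left: "pr (scl a x) y = a * pr x y"
proof -
  have "Vector_Spaces.linear scl (*) (\<lambda>x. pr x y)"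
    using pairing by (simp add: shapovalov_pairing_def)
  then show ?thesis
    by (rule module_hom.scale[OF Vector_Spaces.linear.axioms(3)])
qed

lemma pr_adjoint: "pr (act (gen g) x) y = pr x (act' (gen (sigma_gen g)) y)"
  using pairing by (simp add: shapovalov_pairing_def sigma_gen)

lemma K_\<theta>: "act (qK \<mu>) (\<theta> \<beta>) = scl (ev (lam_pair (- qvec \<alpha> \<beta>) (pvec \<alpha> \<mu>))) (\<theta> \<beta>)"
  using whittaker by (simp add: whittaker_vector_def weight_space_def ev_def)

lemma K_\<theta>': "act' (qK \<mu>) (\<theta>' \<beta>) = scl' (inverse (ev (lam_pair (- qvec \<alpha> \<beta>) (pvec \<alpha> \<mu>)))) (\<theta>' \<beta>)"
  using whittaker' by (simp add: whittaker_vector_def weight_space_def vexp_inverse)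

lemma \<theta>'_0: "\<theta>' (\<lambda>i. 0) = one'"
  using whittaker' by (simp add: whittaker_vector_def)

lemma E_one': "act' (qE i) one' = 0"
proof -
  have "qE i \<in> verma_ideal \<alpha> N (inverse vroot) (\<lambda>i. inverse (uvar i))"
    unfolding verma_ideal_def by (rule hull_inc) blast
  then show ?thesis using verma' by (simp add: verma_module_def)
qed

lemma K_one': "act' (qK \<mu>) one' = scl' (inverse (ev (lam_pair 0 (pvec \<alpha> \<mu>)))) one'"
  using K_\<theta>'[of \<mu> "\<lambda>i. 0"] by (simp add: \<theta>'_0 qvec_def)

lemma F_span_W: "F_span scl' (\<lambda>i. act' (qF i)) one' = UNIV"
proof (rule W.F_span_UNIV)
  show "\<And>m. \<exists>x. m = act' x one'" using verma' by (simp add: verma_module_def)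
qed (use K_one' in \<open>auto simp: E_one'\<close>)

text \<open>\<sigma> sends K at -\<mu> to K at \<mu>, so the adjoint acts on
  \<open>\<theta> \<beta>\<close> with the inverse weight.\<close>

lemma \<psi>_K: "\<psi> \<beta> (act' (qK \<mu>) y) = inverse (ev (lam_pair (- qvec \<alpha> \<beta>) (pvec \<alpha> \<mu>))) * \<psi> \<beta> y"
proof -
  have "\<psi> \<beta> (act' (qK \<mu>) y) = pr (act (qK (\<lambda>j. - \<mu> j)) (\<theta> \<beta>)) y"
    by (simp add: \<psi>_def pr_adjoint)
  then show ?thesis
    by (simp add: K_\<theta> pr_scale_left \<psi>_def pvec_uminus lam_pair_uminus ev_minus lam_pair_lattice)
qed

text \<open>By adjunction \<open>F i\<close> becomes E_i on \<theta>, to which the Whittaker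
  equation applies. The K in that equation acts before E_i, on the component of degree \<beta> +
  \<alpha>_i, which is the degree used in \<open>F_exp\<close>.\<close>

lemma \<psi>_F: "\<psi> (\<beta>(i := Suc (\<beta> i))) (act' (qF i) y) = c i / ev (F_exp i \<beta>) * \<psi> \<beta> y"
proof -
  let ?\<theta> = "\<theta> (\<beta>(i := Suc (\<beta> i)))"
  have "act (qE i * qK (n i)) ?\<theta> = scl (c i) (\<theta> \<beta>)"
    using whittaker by (simp add: whittaker_vector_def)
  then have "scl (ev (F_exp i \<beta>)) (act (qE i) ?\<theta>) = scl (c i) (\<theta> \<beta>)"
    by (simp add: V.act_left K_\<theta> V.act_right F_exp_def)
  then have "pr (scl (ev (F_exp i \<beta>)) (act (qE i) ?\<theta>)) y = pr (scl (c i) (\<theta> \<beta>)) y"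
    by simp
  then show ?thesis
    using ev_nonzero[of "F_exp i \<beta>"] by (simp add: pr_scale_left pr_adjoint \<psi>_def field_simps)
qed

section \<open>Separation of weights\<close>

abbreviation \<omega> :: "'i \<Rightarrow> 'i \<Rightarrow> int" where
  "\<omega> i \<equiv> (\<lambda>j. if j = i then 1 else 0)"

lemma pvec_\<omega>: "pvec \<alpha> (\<omega> i) = fund_weight \<alpha> i"
  by (simp add: fund_weight_eq_pvec)

text \<open>The eigenvalue of K at \<omega>_i, over v^-1, in any degree whose i-th coordinate is k.
  Testing one coordinate at a time avoids decomposing the module into all its weight spaces.\<close>

definition weight_value :: "'i \<Rightarrow> nat \<Rightarrow> 'i kfield" where
  "weight_value i k = inverse (ev (lam_pair 0 (fund_weight \<alpha> i) - num (real k * dd \<alpha> i)))"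

lemma weight_value_Suc: "weight_value i (Suc k) = ev (num (dd \<alpha> i)) * weight_value i k"
proof -
  have eq: "lam_pair 0 (fund_weight \<alpha> i) - num (real (Suc k) * dd \<alpha> i)
      = lam_pair 0 (fund_weight \<alpha> i) - num (real k * dd \<alpha> i) - num (dd \<alpha> i)"
    by (simp add: num_def ring_distribs)
  have "lam_pair 0 (fund_weight \<alpha> i) - num (real k * dd \<alpha> i) \<in> lattice"
    by (intro lattice_intros(3,7) num_lattice_intros num_in_lattice weights_intros)
      (auto simp: fund_weight_eq_pvec weights_intros)
  then show ?thesis
    unfolding weight_value_def eq by (simp add: ev_diff[of _ "num (dd \<alpha> i)"] num_in_lattice divide_inverse)
qed

lemma weight_value_eq: "weight_value i k = ev (num (dd \<alpha> i)) ^ k * weight_value i 0"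
  by (induction k) (simp_all add: weight_value_Suc)

lemma weight_value_inj: "weight_value i k = weight_value i 0 \<longleftrightarrow> k = 0"
proof -
  have "weight_value i 0 \<noteq> 0" by (simp add: weight_value_def ev_nonzero)
  then show ?thesis
    using v_power_eq_1[of i k] unfolding weight_value_eq[of i k] vi_eq by simp
qed

lemma \<psi>_K_\<omega>: "\<psi> \<beta> (act' (qK (\<omega> i)) y) = weight_value i (\<beta> i) * \<psi> \<beta> y"
proof -
  have "fund_weight \<alpha> i \<bullet> qvec \<alpha> \<beta> = real (\<beta> i) * dd \<alpha> i"
    by (simp add: qvec_def inner_sum_right fund_weight_inner if_distrib[of "(*) _"] cong: if_cong)
  then have "lam_pair (- qvec \<alpha> \<beta>) (fund_weight \<alpha> i) = lam_pair 0 (fund_weight \<alpha> i) - num (real (\<beta> i) * dd \<alpha> i)"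
    by (simp add: lam_pair_def num_def inner_commute[of "qvec \<alpha> \<beta>"])
  then show ?thesis by (simp only: \<psi>_K pvec_\<omega> weight_value_def)
qed

text \<open>\<open>\<psi> \<beta>\<close> is itself an eigenfunctional, with eigenvalue
  \<open>weight_value i (\<beta> i)\<close>; it kills eigenvectors of a different eigenvalue. The
  case treated is a zero coordinate against a positive one.\<close>

lemma \<psi>_eigenvector:
  assumes "act' (qK (\<omega> i)) y = scl' (weight_value i k) y" and "k = 0 \<longleftrightarrow> \<beta> i \<noteq> 0" and "k = 0 \<or> \<beta> i = 0"
  shows "\<psi> \<beta> y = 0"
proof -
  have "weight_value i k * \<psi> \<beta> y = weight_value i (\<beta> i) * \<psi> \<beta> y"
    using \<psi>_K_\<omega>[of \<beta> i y] by (simp add: assms(1) \<psi>_right)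
  moreover have "weight_value i k \<noteq> weight_value i (\<beta> i)"
    using assms(2,3) weight_value_inj by metis
  ultimately show ?thesis by simp
qed

lemma \<psi>_one: "\<psi> \<beta> one' = (if \<beta> = (\<lambda>i. 0) then 1 else 0)"
proof (cases "\<beta> = (\<lambda>i. 0)")
  case True
  then show ?thesis
    using whittaker pairing by (simp add: \<psi>_def whittaker_vector_def shapovalov_pairing_def)
next
  case False
  then obtain i where "\<beta> i \<noteq> 0" by auto
  moreover have "act' (qK (\<omega> i)) one' = scl' (weight_value i 0) one'"
    by (simp add: K_one' pvec_\<omega> weight_value_def num_def zero_prod_def[symmetric])
  ultimately show ?thesis using False \<psi>_eigenvector[of i one' 0 \<beta>] by simp
qed

text \<open>Sums of \<open>K\<close>-eigenvectors whose weights lie below the highest one.\<close>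

inductive_set graded :: "'i \<Rightarrow> 'w set" for i where
  eigen: "act' (qK (\<omega> i)) y = scl' (weight_value i k) y \<Longrightarrow> y \<in> graded i"
| add: "x \<in> graded i \<Longrightarrow> y \<in> graded i \<Longrightarrow> x + y \<in> graded i"

lemma K_\<omega>_F:
  assumes "act' (qK (\<omega> i)) y = scl' (weight_value i k) y"
  shows "act' (qK (\<omega> i)) (act' (qF j) y) = scl' (weight_value i (if j = i then Suc k else k)) (act' (qF j) y)"
  by (simp add: W.K_F assms W.act_right vpow_inverse pvec_\<omega> fund_weight_inner ev_num_uminus
      num_in_lattice weight_value_Suc num_def[of 0] zero_prod_def[symmetric] ev_0)

lemma graded_UNIV: "y \<in> graded i"
proof -
  have "y \<in> F_span scl' (\<lambda>i. act' (qF i)) one'" by (simp add: F_span_W)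
  then show ?thesis
  proof (induction rule: F_span.induct)
    case one
    show ?case
      by (rule graded.eigen[of _ _ 0])
        (simp add: K_one' pvec_\<omega> weight_value_def num_def zero_prod_def[symmetric])
  next
    case (scale x a)
    from scale.IH show ?case
    proof (induction rule: graded.induct)
      case (eigen y k)
      then have "act' (qK (\<omega> i)) (scl' a y) = scl' (weight_value i k) (scl' a y)"
        by (simp add: W.act_right mult.commute)
      then show ?case by (rule graded.eigen)
    qed (simp add: W.scale_right_distrib graded.add)
  next
    case (F x j)
    from F.IH show ?case
      by (induction rule: graded.induct) (auto simp: W.act_right intro: graded.add graded.eigen[OF K_\<omega>_F])
  qed (rule graded.add)
qed

text \<open>On an eigenvector, \<open>F i\<close> raises the coordinate from k to
  \<open>Suc k\<close>, which never matches the coordinate 0 of \<beta>. By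
  \<open>graded_UNIV\<close> and additivity this suffices.\<close>

lemma \<psi>_F_0:
  assumes "\<beta> i = 0"
  shows "\<psi> \<beta> (act' (qF i) y) = 0"
  using graded_UNIV[of y i]
proof (induction rule: graded.induct)
  case (eigen y k)
  from K_\<omega>_F[OF eigen, of i] show ?case
    using assms by (intro \<psi>_eigenvector[of i _ "Suc k"]) simp_all
next
  case (add x y)
  then show ?case by (simp add: W.act_right \<psi>_right)
qed

definition indices :: "'i list" where
  "indices = (SOME xs. distinct xs \<and> set xs = UNIV \<and> sorted_wrt before xs)"

lemma indices: "distinct indices" "set indices = UNIV" "sorted_wrt before indices"
proof -
  \<comment> \<open>Making \<open>before\<close> a linear order on the labels, different from the
    one of the type, gives access to sorted enumerations of a finite set.\<close>
  have "class.linorder (\<lambda>i j. i = j \<or> before i j) before"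
    by unfold_locales (use before_irrefl before_trans before_asym before_total in blast)+
  from linorder.finite_sorted_distinct_unique[OF this, of UNIV]
  obtain xs where xs: "set xs = UNIV" "sorted_wrt (\<lambda>i j. i = j \<or> before i j) xs" "distinct xs"
    by auto
  have "sorted_wrt before xs"
    using xs(2,3) by (induction xs) auto
  with xs have "\<exists>xs. distinct xs \<and> set xs = UNIV \<and> sorted_wrt before xs" by blast
  from someI_ex[OF this, folded indices_def]
  show "distinct indices" "set indices = UNIV" "sorted_wrt before indices" by blast+
qed

text \<open>The parameter is the inverse of v_i because \<open>\<psi>\<close> lives on the module
  over v^-1. The eigenvalue appears uninverted, since \<open>casimir_exp\<close> already carries the
  sign.\<close>

sublocale whittaker_recursion scl' "\<lambda>i. act' (qE i)" "\<lambda>i. act' (qF i)" "\<lambda>i. act' (qKalpha \<alpha> i)"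
  "\<lambda>i. act' (qKalpha_inv \<alpha> i)" one' "\<lambda>i. inverse (vq i)" "\<lambda>i j. inverse (ev (num (\<alpha> i \<bullet> \<alpha> j)))"
  \<psi> "\<lambda>i \<gamma>. inverse (ev (lam_pair (- qvec \<alpha> \<gamma>) (\<alpha> i)))" "\<lambda>i \<delta>. c i / ev (F_exp i \<delta>)"
  before indices C "\<lambda>\<beta>. ev (casimir_exp \<beta>)" "\<lambda>i \<gamma> m. inverse (ev (H_exp i \<gamma> m))"
proof (intro whittaker_recursion.intro whittaker_functional.intro whittaker_functional_axioms.intro
    whittaker_recursion_axioms.intro W.vector_space_axioms)
  fix i j :: 'i and y :: 'w and \<beta> m \<delta> \<gamma> :: "'i \<Rightarrow> nat"
  show "Vector_Spaces.linear scl' scl' (act' (qE i))" "Vector_Spaces.linear scl' scl' (act' (qF i))"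
    by (rule W.act_linear)+
  show "Vector_Spaces.linear scl' (*) (\<psi> \<beta>)" by (rule linear_\<psi>)
  show "act' (qE i) (act' (qF j) y) = act' (qF j) (act' (qE i) y) +
      (if i = j then scl' (inverse (inverse (vq i) - inverse (inverse (vq i))))
        (act' (qKalpha \<alpha> i) y - act' (qKalpha_inv \<alpha> i) y) else 0)"
    unfolding W.E_F vi_inverse ..
  show "act' (qKalpha \<alpha> i) (act' (qE j) y) =
      scl' (inverse (ev (num (\<alpha> i \<bullet> \<alpha> j)))) (act' (qE j) (act' (qKalpha \<alpha> i) y))"
    unfolding qKalpha_def W.K_E[of "\<lambda>j. cartan \<alpha> j i"] by (simp add: pvec_cartan vpow_inverse)
  show "act' (qKalpha_inv \<alpha> i) (act' (qE j) y) =
      scl' (inverse (inverse (ev (num (\<alpha> i \<bullet> \<alpha> j))))) (act' (qE j) (act' (qKalpha_inv \<alpha> i) y))"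
    unfolding qKalpha_inv_def W.K_E[of "\<lambda>j. - cartan \<alpha> j i"]
    by (simp add: pvec_uminus pvec_cartan vpow_inverse ev_num_uminus num_in_lattice weights_intros)
  show "inverse (ev (num (\<alpha> i \<bullet> \<alpha> i))) = (inverse (vq i))\<^sup>2"
  proof -
    have "num (\<alpha> i \<bullet> \<alpha> i) = (num (real 2 * dd \<alpha> i) :: 'e \<times> real)" by (simp add: dd_def)
    then show ?thesis by (simp only: ev_num_mult num_in_lattice vi_eq power_inverse)
  qed
  show "inverse (ev (num (\<alpha> i \<bullet> \<alpha> j))) \<noteq> 0" by (simp add: ev_nonzero)
  show "inverse (vq i) \<noteq> inverse (inverse (vq i))" using v_neq_inverse[of i] by auto
  show "act' (qE i) one' = 0" by (rule E_one')
  show "\<psi> \<beta> one' = (if \<beta> = (\<lambda>i. 0) then 1 else 0)" by (rule \<psi>_one)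
  show "\<psi> \<beta> (act' (qKalpha \<alpha> i) y) = inverse (ev (lam_pair (- qvec \<alpha> \<beta>) (\<alpha> i))) * \<psi> \<beta> y"
    unfolding qKalpha_def \<psi>_K by (simp add: pvec_cartan)
  show "\<psi> \<beta> (act' (qKalpha_inv \<alpha> i) y) = inverse (inverse (ev (lam_pair (- qvec \<alpha> \<beta>) (\<alpha> i)))) * \<psi> \<beta> y"
    unfolding qKalpha_inv_def \<psi>_K using lam_pair_lattice[of \<beta> "\<lambda>j. cartan \<alpha> j i"]
    by (simp add: pvec_uminus pvec_cartan lam_pair_uminus ev_minus)
  show "\<psi> (\<beta>(i := Suc (\<beta> i))) (act' (qF i) y) = c i / ev (F_exp i \<beta>) * \<psi> \<beta> y" by (rule \<psi>_F)
  show "\<beta> i = 0 \<Longrightarrow> \<psi> \<beta> (act' (qF i) y) = 0" by (rule \<psi>_F_0)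
  show "before i j \<Longrightarrow> \<not> before j i" by (rule before_asym)
  show "distinct indices" "set indices = UNIV" "sorted_wrt before indices" by (rule indices)+
  show "C \<beta> (\<lambda>i. 0) = 1" by (rule C_0)
  show "ev (casimir_exp (\<lambda>i. 0)) = 1"
    by (simp add: casimir_exp_def qvec_def lam_pair_def num_def zero_prod_def[symmetric] ev_0)
  show "ev (casimir_exp \<beta>) \<noteq> 0" by (rule ev_nonzero)
  show "inverse (ev (H_exp i \<gamma> m)) = inverse (ev (lam_pair (- qvec \<alpha> \<gamma>) (\<alpha> i))) /
      (inverse (vq i) ^ m i * (\<Prod>j | before j i. inverse (ev (num (\<alpha> i \<bullet> \<alpha> j))) ^ m j))"
    by (rule H_eq[symmetric])
  show "m \<le> \<delta> \<Longrightarrow> C (\<delta>(i := Suc (\<delta> i))) m * (c i / ev (F_exp i (\<delta> - m)))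
      + C (\<delta>(i := Suc (\<delta> i))) (m(i := Suc (m i)))
        * (qint (inverse (vq i)) (Suc (m i)) / (inverse (vq i) - inverse (inverse (vq i))))
        * (inverse (ev (H_exp i (\<delta> - m) m)) - inverse (inverse (ev (H_exp i (\<delta> - m) m))))
      = ev (casimir_exp (\<delta>(i := Suc (\<delta> i)))) / ev (casimir_exp \<delta>) * (c i / ev (F_exp i \<delta>)) * C \<delta> m"
    by (rule C_coefficients)
qed

section \<open>Raising operators on the second Whittaker vector\<close>

lemma E_\<theta>':
  "act' (qE i) (\<theta>' (\<beta>(i := Suc (\<beta> i)))) =
     scl' (c' i * ev (lam_pair (- qvec \<alpha> (\<beta>(i := Suc (\<beta> i)))) (\<nu>' i))) (\<theta>' \<beta>)"
proof -
  let ?\<theta> = "\<theta>' (\<beta>(i := Suc (\<beta> i)))" and ?e = "ev (lam_pair (- qvec \<alpha> (\<beta>(i := Suc (\<beta> i)))) (\<nu>' i))"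
  have "act' (qE i * qK (n' i)) ?\<theta> = scl' (c' i) (\<theta>' \<beta>)"
    using whittaker' by (simp add: whittaker_vector_def)
  then have "scl' (inverse ?e) (act' (qE i) ?\<theta>) = scl' (c' i) (\<theta>' \<beta>)"
    by (simp add: W.act_left K_\<theta>' W.act_right)
  then have "scl' ?e (scl' (inverse ?e) (act' (qE i) ?\<theta>)) = scl' ?e (scl' (c' i) (\<theta>' \<beta>))"
    by simp
  then show ?thesis by (simp add: ev_nonzero mult.commute)
qed

text \<open>The t-th application, counted from 0, acts after the degree has dropped by t \<alpha>_i
  and so contributes an additional t (\<nu>'_i, \<alpha>_i); these add up to a triangular
  number.\<close>

lemma E_pow_\<theta>':
  assumes "k \<le> \<gamma> i"
  shows "(act' (qE i) ^^ k) (\<theta>' \<gamma>) =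
    scl' (c' i ^ k * ev (real k *\<^sub>R lam_pair (- qvec \<alpha> \<gamma>) (\<nu>' i) + num (real k * (real k - 1) / 2 * (\<nu>' i \<bullet> \<alpha> i))))
      (\<theta>' (\<gamma>(i := \<gamma> i - k)))"
  using assms
proof (induction k)
  case 0
  then show ?case by (simp add: num_def zero_prod_def[symmetric] ev_0)
next
  case (Suc k)
  define \<delta> where "\<delta> = \<gamma>(i := \<gamma> i - Suc k)"
  have \<delta>: "\<gamma>(i := \<gamma> i - k) = \<delta>(i := Suc (\<delta> i))"
    using Suc.prems by (auto simp: \<delta>_def fun_eq_iff)
  define x where "x = real k *\<^sub>R lam_pair (- qvec \<alpha> \<gamma>) (\<nu>' i) + num (real k * (real k - 1) / 2 * (\<nu>' i \<bullet> \<alpha> i))"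
  define y where "y = lam_pair (- qvec \<alpha> (\<gamma>(i := \<gamma> i - k))) (\<nu>' i)"
  have x: "x \<in> lattice" and y: "y \<in> lattice"
    unfolding x_def y_def
    by (intro lattice_intros(2,5) lam_pair_lattice num_lattice_intros num_in_lattice weights_intros half_Ints Ints_of_nat)+
  have q: "qvec \<alpha> (\<gamma>(i := \<gamma> i - k)) = qvec \<alpha> \<gamma> - real k *\<^sub>R \<alpha> i"
    using Suc.prems
    by (simp add: qvec_def sum.remove[of UNIV i] of_nat_diff algebra_simps)
  have xy: "real (Suc k) *\<^sub>R lam_pair (- qvec \<alpha> \<gamma>) (\<nu>' i) + num (real (Suc k) * (real (Suc k) - 1) / 2 * (\<nu>' i \<bullet> \<alpha> i)) = x + y"
    by (simp add: x_def y_def q num_def lam_pair_def prod_eq_iff inner_diff_left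
        inner_commute[of "\<alpha> i"] field_simps)
  have "(act' (qE i) ^^ Suc k) (\<theta>' \<gamma>) = scl' (c' i ^ k * ev x) (act' (qE i) (\<theta>' (\<gamma>(i := \<gamma> i - k))))"
    unfolding funpow.simps o_apply Suc.IH[OF Suc_leD[OF Suc.prems], folded x_def] W.act_right ..
  also have "act' (qE i) (\<theta>' (\<gamma>(i := \<gamma> i - k))) = scl' (c' i * ev y) (\<theta>' \<delta>)"
    unfolding y_def \<delta> by (rule E_\<theta>')
  finally show ?case
    unfolding xy ev_add[OF x y] \<delta>_def[symmetric] by (simp add: mult_ac)
qed

lemma E_prod_\<theta>':
  assumes "distinct is" "sorted_wrt before is" "\<And>j. m j \<noteq> 0 \<Longrightarrow> j \<in> set is" "m \<le> \<beta>"
  shows "E_prod m is (\<theta>' \<beta>) =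
    scl' ((\<Prod>i\<in>UNIV. c' i ^ m i) * ev (E_exp \<beta> m)) (\<theta>' (\<beta> - m))"
  using assms
proof (induction "is" arbitrary: m)
  case Nil
  then have m: "m = (\<lambda>i. 0)" by auto
  have "E_exp \<beta> m = 0" by (simp add: m E_exp_def quadratic_def num_def prod_eq_iff)
  moreover have "\<beta> - m = \<beta>" by (auto simp: m)
  ultimately show ?case by (simp add: m E_prod_def ev_0)
next
  case (Cons i "is")
  \<comment> \<open>Deleting the coordinate of the leftmost factor leaves an index supported on the
    tail of the list, as the induction hypothesis requires.\<close>
  define m' where "m' = m(i := 0)"
  have m: "m = m'(i := m i)" by (simp add: m'_def)
  have m'_le: "m' \<le> \<beta>" using Cons.prems(4) by (auto simp: m'_def le_fun_def)
  have supp: "m' j \<noteq> 0 \<Longrightarrow> j \<in> set is" for j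
    using Cons.prems(3)[of j] by (auto simp: m'_def split: if_splits)
  have exp: "E_exp \<beta> m = E_exp \<beta> m' + (real (m i) *\<^sub>R lam_pair (- qvec \<alpha> (\<beta> - m')) (\<nu>' i)
      + num (real (m i) * (real (m i) - 1) / 2 * (\<nu>' i \<bullet> \<alpha> i)))" (is "_ = _ + ?x")
  proof (subst m, rule E_exp_upd)
    show "m' i = 0" by (simp add: m'_def)
    show "m' \<le> \<beta>" by (rule m'_le)
    show "m' j \<noteq> 0 \<Longrightarrow> before i j" for j using supp Cons.prems(2) by auto
  qed
  have x: "?x \<in> lattice"
    by (intro lattice_intros(2,5) lam_pair_lattice[where \<beta> = "\<beta> - m'"] num_lattice_intros num_in_lattice
        weights_intros half_Ints Ints_of_nat)
  have target: "(\<beta> - m')(i := (\<beta> - m') i - m i) = \<beta> - m"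
    by (auto simp: m'_def fun_eq_iff)
  have "E_prod m (i # is) (\<theta>' \<beta>) = (act' (qE i) ^^ m i) (E_prod m' is (\<theta>' \<beta>))"
    unfolding E_prod_Cons using Cons.prems(1) by (subst E_prod_cong[of "is" m m']) (auto simp: m'_def)
  also have "E_prod m' is (\<theta>' \<beta>) = scl' ((\<Prod>i\<in>UNIV. c' i ^ m' i) * ev (E_exp \<beta> m')) (\<theta>' (\<beta> - m'))"
    using Cons.prems by (intro Cons.IH supp m'_le) auto
  also have "(act' (qE i) ^^ m i) \<dots> = scl' ((\<Prod>i\<in>UNIV. c' i ^ m' i) * ev (E_exp \<beta> m'))
      (scl' (c' i ^ m i * ev ?x) (\<theta>' (\<beta> - m)))"
    unfolding E_pow_linear(2) target[symmetric]
    by (subst E_pow_\<theta>') (use Cons.prems(4) in \<open>auto simp: m'_def le_fun_def\<close>)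
  also have "\<dots> = scl' ((\<Prod>i\<in>UNIV. c' i ^ m i) * ev (E_exp \<beta> m)) (\<theta>' (\<beta> - m))"
    unfolding exp ev_add[OF E_exp_lattice x] by (simp add: m'_def prod.remove[of UNIV i] mult_ac)
  finally show ?case .
qed

section \<open>Normalization and the final recursion\<close>

definition norm_exp :: "('i \<Rightarrow> nat) \<Rightarrow> 'e \<times> real" where
  "norm_exp \<beta> = num (- (qvec \<alpha> \<beta> \<bullet> qvec \<alpha> \<beta>) / 2) + lam_pair 0 (qvec \<alpha> \<beta>)"

lemma norm_exp_lattice: "norm_exp \<beta> \<in> lattice"
proof -
  have "num (- (qvec \<alpha> \<beta> \<bullet> qvec \<alpha> \<beta>) / 2) = - num (qvec \<alpha> \<beta> \<bullet> qvec \<alpha> \<beta> / 2)"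
    by (simp add: num_def)
  then show ?thesis
    unfolding norm_exp_def
    by (metis lattice_intros(1,2,4,7) num_in_lattice(3) qvec_in_weights weights_intros(1))
qed

lemma Jtilde_eq: "Jtilde \<alpha> N pr \<theta> \<theta>' \<beta> = ev (norm_exp \<beta>) * \<psi> \<beta> (\<theta>' \<beta>)"
  by (simp add: Jtilde_def norm_exp_def ev_def \<psi>_def)

definition step_exp :: "('i \<Rightarrow> nat) \<Rightarrow> real" where
  "step_exp m = (\<Sum>i\<in>UNIV. real (m i) * (real (m i) + 1) / 2 * dd \<alpha> i)"

lemma half_Ints_Suc: "real k * (real k + 1) / 2 \<in> \<int>"
  using half_Ints[of "Suc k"] by (simp add: mult.commute add.commute)

lemma step_lattice: "num (real k * (real k + 1) / 2 * dd \<alpha> i) \<in> lattice"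
  by (intro num_lattice_intros half_Ints_Suc num_in_lattice)

text \<open>Factor by factor, 1 - v^(2k) = -(v - v^-1) [k] v^k at v = v_i; the exponents k add up to
  a triangular number.\<close>

lemma qpoch_eq:
  "qpoch ((vq i)\<^sup>2) k = (- (vq i - inverse (vq i))) ^ k * qfact (inverse (vq i)) k
     * ev (num (real k * (real k + 1) / 2 * dd \<alpha> i))"
proof (induction k)
  case 0
  then show ?case by (simp add: qpoch_def qfact_def num_def zero_prod_def[symmetric] ev_0)
next
  case (Suc k)
  define d where "d = vq i - inverse (vq i)"
  define x where "x = vq i ^ Suc k"
  have d0: "d \<noteq> 0" using v_neq_inverse by (simp add: d_def)
  have x0: "x \<noteq> 0" using v_nonzero by (simp add: x_def)
  have "num (real (Suc k) * (real (Suc k) + 1) / 2 * dd \<alpha> i)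
      = (num (real k * (real k + 1) / 2 * dd \<alpha> i) + num (real (Suc k) * dd \<alpha> i) :: 'e \<times> real)"
    by (simp add: num_def field_simps)
  moreover have "num (real (Suc k) * dd \<alpha> i) \<in> lattice"
    by (intro num_lattice_intros num_in_lattice Ints_of_nat)
  ultimately have e: "ev (num (real (Suc k) * (real (Suc k) + 1) / 2 * dd \<alpha> i))
      = ev (num (real k * (real k + 1) / 2 * dd \<alpha> i)) * x"
    using ev_num_mult[of "dd \<alpha> i" "Suc k"] num_in_lattice
    by (simp only: ev_add step_lattice vi_eq x_def)
  have "qpoch ((vq i)\<^sup>2) (Suc k) = qpoch ((vq i)\<^sup>2) k * (1 - x * x)"
    by (simp add: qpoch_def x_def power_mult[symmetric] power_add[symmetric] mult_2)
  moreover have "qfact (inverse (vq i)) (Suc k) = qfact (inverse (vq i)) k * ((x - inverse x) / d)"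
    using qint_v[of i "Suc k"] by (simp add: qfact_def x_def d_def)
  moreover have "1 - x * x = - d * ((x - inverse x) / d) * x"
    using d0 x0 by (simp add: field_simps)
  ultimately show ?case
    unfolding e Suc.IH d_def[symmetric] power_Suc by (simp only: mult_ac)
qed

lemma qfact_v_nonzero: "qfact (inverse (vq i)) k \<noteq> 0"
  by (induction k) (simp_all add: qfact_def qint_v_nonzero)

text \<open>The powers of -(v_i - v_i^-1) in \<open>qpoch_eq\<close> supply the sign and the second
  factor v_i - v_i^-1 in \<open>c_power\<close>, and \<open>step_exp\<close> undoes its powers of
  v.\<close>

lemma prefactor_eq:
  "prefactor m * (\<Prod>i\<in>UNIV. c' i ^ m i) = c_power \<alpha> N c c' m / v2_poch \<alpha> N m * ev (num (step_exp m))"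
proof -
  have "((vq i - inverse (vq i)) * c i) ^ m i / qfact (inverse (vq i)) (m i) * c' i ^ m i
      = (- c i * c' i * (vq i - inverse (vq i))\<^sup>2) ^ m i / qpoch ((vq i)\<^sup>2) (m i)
        * ev (num (real (m i) * (real (m i) + 1) / 2 * dd \<alpha> i))" for i
  proof -
    define d where "d = vq i - inverse (vq i)"
    have "d \<noteq> 0" using v_neq_inverse by (simp add: d_def)
    have "- c i * c' i * d\<^sup>2 = (- d) * (d * c i * c' i)" by (simp add: power2_eq_square)
    then have p: "(- c i * c' i * d\<^sup>2) ^ k = (- d) ^ k * ((d * c i) ^ k * c' i ^ k)" for k
      by (simp only: power_mult_distrib mult.assoc)
    have "(- d) ^ m i \<noteq> 0" using \<open>d \<noteq> 0\<close> by simp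
    then show ?thesis
      unfolding qpoch_eq d_def[symmetric] p
      using ev_nonzero[of "num (real (m i) * (real (m i) + 1) / 2 * dd \<alpha> i)"] qfact_v_nonzero[of i "m i"]
      by (simp add: divide_simps del: power_mult_distrib)
  qed
  then have "prefactor m * (\<Prod>i\<in>UNIV. c' i ^ m i) =
    (\<Prod>i\<in>UNIV. (- c i * c' i * (vq i - inverse (vq i))\<^sup>2) ^ m i / qpoch ((vq i)\<^sup>2) (m i)
        * ev (num (real (m i) * (real (m i) + 1) / 2 * dd \<alpha> i)))"
    unfolding prefactor_def prod.distrib[symmetric] by (intro prod.cong refl)
  then show ?thesis
    by (simp only: prod.distrib prod_dividef c_power_def v2_poch_def step_exp_def ev_num_sum[OF step_lattice])
qed

lemma summand_eq:
  assumes "m \<le> \<beta>"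
  defines "\<gamma> \<equiv> \<beta> - m"
  shows "ev (norm_exp \<beta>) / ev (casimir_exp \<beta>) * (C \<beta> m * ((\<Prod>i\<in>UNIV. c' i ^ m i) * ev (E_exp \<beta> m)))
    = 1 / v2_poch \<alpha> N m
       * ev (num (qvec \<alpha> \<gamma> \<bullet> qvec \<alpha> \<gamma>) - 2 *\<^sub>R lam_pair (weyl_vector \<alpha>) (qvec \<alpha> \<gamma>))
       * c_power \<alpha> N c c' m * ev (tau \<alpha> prec n n' m \<beta>) * ev (norm_exp \<gamma>)"
proof -
  define x where "x = num (step_exp m) + E_exp \<beta> m - C_exp \<beta> m + norm_exp \<beta> - casimir_exp \<beta> - norm_exp \<gamma>"
  define y where "y = num (qvec \<alpha> \<gamma> \<bullet> qvec \<alpha> \<gamma>) - 2 *\<^sub>R lam_pair (weyl_vector \<alpha>) (qvec \<alpha> \<gamma>)"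
  have xy: "x = y + tau \<alpha> prec n n' m \<beta>"
    using exponent_identity[OF assms(1)] by (simp add: x_def y_def norm_exp_def step_exp_def \<gamma>_def)
  have step: "num (step_exp m) \<in> lattice"
    unfolding step_exp_def by (intro num_sum_lattice step_lattice)
  note lat = step E_exp_lattice C_exp_lattice norm_exp_lattice casimir_exp_lattice
  have y: "y \<in> lattice"
    unfolding y_def by (intro lattice_intros num_in_lattice weyl_vector_in_weights qvec_in_weights Ints_numeral)
  have x: "x \<in> lattice"
    unfolding x_def by (intro lattice_intros(2,3) lat)
  \<comment> \<open>Integrality of \<open>tau\<close> follows from that of the other exponents
    through the identity \<open>xy\<close>.\<close>
  have "tau \<alpha> prec n n' m \<beta> = x - y" by (simp add: xy)
  with x y have tau: "tau \<alpha> prec n n' m \<beta> \<in> lattice" by (simp add: lattice_intros)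
  have "ev x = ev (num (step_exp m)) * ev (E_exp \<beta> m) / ev (C_exp \<beta> m) * ev (norm_exp \<beta>)
      / ev (casimir_exp \<beta>) / ev (norm_exp \<gamma>)"
    unfolding x_def by (simp add: ev_add ev_diff lattice_intros(2,3) lat)
  then have "ev (num (step_exp m)) * ev (E_exp \<beta> m) / ev (C_exp \<beta> m) * ev (norm_exp \<beta>) / ev (casimir_exp \<beta>)
      = ev y * ev (tau \<alpha> prec n n' m \<beta>) * ev (norm_exp \<gamma>)"
    unfolding xy ev_add[OF y tau] using ev_nonzero[of "norm_exp \<gamma>"] by (simp add: field_simps)
  then have "c_power \<alpha> N c c' m / v2_poch \<alpha> N m * (ev (num (step_exp m)) * ev (E_exp \<beta> m) / ev (C_exp \<beta> m)
        * ev (norm_exp \<beta>) / ev (casimir_exp \<beta>))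
      = c_power \<alpha> N c c' m / v2_poch \<alpha> N m * (ev y * ev (tau \<alpha> prec n n' m \<beta>) * ev (norm_exp \<gamma>))"
    by simp
  moreover have "ev (norm_exp \<beta>) / ev (casimir_exp \<beta>) * (C \<beta> m * ((\<Prod>i\<in>UNIV. c' i ^ m i) * ev (E_exp \<beta> m)))
      = prefactor m * (\<Prod>i\<in>UNIV. c' i ^ m i) * (ev (E_exp \<beta> m) / ev (C_exp \<beta> m)
        * ev (norm_exp \<beta>) / ev (casimir_exp \<beta>))"
    by (simp add: C_def mult_ac)
  ultimately show ?thesis
    unfolding prefactor_eq y_def[symmetric] by (simp add: mult_ac)
qed

theorem Jtilde_recursion:
  "Jtilde \<alpha> N pr \<theta> \<theta>' \<beta> =
    (\<Sum>\<gamma> | \<gamma> \<le> \<beta>.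
       1 / v2_poch \<alpha> N (\<beta> - \<gamma>)
       * ev (num (qvec \<alpha> \<gamma> \<bullet> qvec \<alpha> \<gamma>) - 2 *\<^sub>R lam_pair (weyl_vector \<alpha>) (qvec \<alpha> \<gamma>))
       * c_power \<alpha> N c c' (\<beta> - \<gamma>)
       * ev (tau \<alpha> prec n n' (\<beta> - \<gamma>) \<beta>)
       * Jtilde \<alpha> N pr \<theta> \<theta>' \<gamma>)" (is "_ = (\<Sum>\<gamma> | \<gamma> \<le> \<beta>. ?t \<gamma>)")
proof -
  let ?J = "\<lambda>\<gamma>. \<psi> \<gamma> (\<theta>' \<gamma>)"
  have E_prod: "\<psi> (\<beta> - m) (E_prod m indices (\<theta>' \<beta>)) = (\<Prod>i\<in>UNIV. c' i ^ m i) * ev (E_exp \<beta> m) * ?J (\<beta> - m)"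
    if "m \<le> \<beta>" for m
    using that indices by (subst E_prod_\<theta>') (simp_all only: UNIV_I \<psi>_right)
  have le_diff: "\<beta> - m \<le> \<beta>" and diff_diff: "m \<le> \<beta> \<Longrightarrow> \<beta> - (\<beta> - m) = m" for m
    by (auto simp: le_fun_def fun_eq_iff)
  have "(\<Sum>m | m \<le> \<beta>. C \<beta> m * ((\<Prod>i\<in>UNIV. c' i ^ m i) * ev (E_exp \<beta> m) * ?J (\<beta> - m)))
      = ev (casimir_exp \<beta>) * ?J \<beta>"
  proof -
    have "(\<Sum>m | m \<le> \<beta>. C \<beta> m * ((\<Prod>i\<in>UNIV. c' i ^ m i) * ev (E_exp \<beta> m) * ?J (\<beta> - m)))
        = (\<Sum>m | m \<le> \<beta>. C \<beta> m * \<psi> (\<beta> - m) (E_prod m indices (\<theta>' \<beta>)))"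
      by (intro sum.cong refl) (simp only: mem_Collect_eq E_prod)
    then show ?thesis
      using recursion[of "\<theta>' \<beta>" \<beta>] by (simp only: F_span_W UNIV_I simp_thms)
  qed
  \<comment> \<open>Dividing by the eigenvalue isolates \<psi> at \<beta>; the term m = 0 stays on
    the right-hand side, just as \<gamma> = \<beta> does in the stated sum.\<close>
  then have "Jtilde \<alpha> N pr \<theta> \<theta>' \<beta> = ev (norm_exp \<beta>) / ev (casimir_exp \<beta>) *
      (\<Sum>m | m \<le> \<beta>. C \<beta> m * ((\<Prod>i\<in>UNIV. c' i ^ m i) * ev (E_exp \<beta> m) * ?J (\<beta> - m)))"
    unfolding Jtilde_eq using ev_nonzero[of "casimir_exp \<beta>"] by simp
  also have "\<dots> = (\<Sum>m | m \<le> \<beta>. ev (norm_exp \<beta>) / ev (casimir_exp \<beta>)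
      * (C \<beta> m * ((\<Prod>i\<in>UNIV. c' i ^ m i) * ev (E_exp \<beta> m))) * ?J (\<beta> - m))"
    by (simp only: sum_distrib_left mult.assoc)
  also have "\<dots> = (\<Sum>m | m \<le> \<beta>. ?t (\<beta> - m))"
    by (intro sum.cong refl) (simp only: mem_Collect_eq summand_eq diff_diff Jtilde_eq mult.assoc)
  \<comment> \<open>The map from m to \<beta> - m is an involution of the indices below \<beta>,
    although the subtraction is truncated.\<close>
  also have "\<dots> = (\<Sum>\<gamma> | \<gamma> \<le> \<beta>. ?t \<gamma>)"
    by (rule sum.reindex_bij_witness[of _ "\<lambda>\<gamma>. \<beta> - \<gamma>" "\<lambda>m. \<beta> - m"])
      (simp_all only: mem_Collect_eq le_diff diff_diff)
  finally show ?thesis .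
qed

end

theorem theorem4p6:
  fixes \<Delta> :: "'e::euclidean_space set"
    and \<alpha> :: "'i::{finite,linorder} \<Rightarrow> 'e"
    and N :: nat
    and \<epsilon>p \<epsilon>m np nm :: "'i \<Rightarrow> 'i \<Rightarrow> int"
    and cp cm :: "'i \<Rightarrow> 'i kfield"
    and prec :: "'e \<Rightarrow> 'e \<Rightarrow> bool"
    and scl :: "'i kfield \<Rightarrow> 'v::ab_group_add \<Rightarrow> 'v"
    and act :: "('i, 'i kfield) qfree \<Rightarrow> 'v \<Rightarrow> 'v"
    and one :: 'v
    and scl' :: "'i kfield \<Rightarrow> 'w::ab_group_add \<Rightarrow> 'w"
    and act' :: "('i, 'i kfield) qfree \<Rightarrow> 'w \<Rightarrow> 'w"
    and one' :: 'w
    and pr :: "'v \<Rightarrow> 'w \<Rightarrow> 'i kfield"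
    and \<theta> :: "('i \<Rightarrow> nat) \<Rightarrow> 'v"
    and \<theta>' :: "('i \<Rightarrow> nat) \<Rightarrow> 'w"
    and \<beta> :: "'i \<Rightarrow> nat"
  assumes "root_system \<Delta>"
    and "simple_roots \<Delta> \<alpha>"
    and "normalized_form \<Delta>"
    and "N > 0"
    and "\<And>\<mu> \<mu>'. real N * (pvec \<alpha> \<mu> \<bullet> pvec \<alpha> \<mu>') \<in> \<int>"
    and "sevostyanov_triple \<alpha> \<epsilon>p np cp"
    and "sevostyanov_triple \<alpha> \<epsilon>m nm cm"
    and "convex_ordering \<Delta> \<alpha> prec"
    and "\<And>i j. \<epsilon>p i j = -1 \<Longrightarrow> prec (\<alpha> i) (\<alpha> j)"
    and "verma_module \<alpha> N vroot uvar scl act one"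
    and "verma_module \<alpha> N (inverse vroot) (\<lambda>i. inverse (uvar i)) scl' act' one'"
    and "shapovalov_pairing scl act one scl' act' one' pr"
    and "whittaker_vector \<alpha> N vroot uvar scl act one np cp \<theta>"
    and "whittaker_vector \<alpha> N (inverse vroot) (\<lambda>i. inverse (uvar i)) scl' act' one' nm cm \<theta>'"
  shows "Jtilde \<alpha> N pr \<theta> \<theta>' \<beta> =
    (\<Sum>\<gamma> | \<gamma> \<le> \<beta>.
       1 / v2_poch \<alpha> N (\<beta> - \<gamma>)
       * vexp \<alpha> N vroot uvar
           (num (qvec \<alpha> \<gamma> \<bullet> qvec \<alpha> \<gamma>) - 2 *\<^sub>R lam_pair (weyl_vector \<alpha>) (qvec \<alpha> \<gamma>))
       * c_power \<alpha> N cp cm (\<beta> - \<gamma>)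
       * vexp \<alpha> N vroot uvar (tau \<alpha> prec np nm (\<beta> - \<gamma>) \<beta>)
       * Jtilde \<alpha> N pr \<theta> \<theta>' \<gamma>)"
proof -
  interpret whittaker_pair \<Delta> \<alpha> N \<epsilon>p np nm cp cm prec scl act one scl' act' one' pr \<theta> \<theta>'
    by unfold_locales fact+
  show ?thesis by (rule Jtilde_recursion[unfolded ev_def])
qed

end
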